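(* Let $V$ be a vector space with dimension $2n\geq 4$ over a field $\mathbb{F}$. Let $\mathbb{L}\subset\mathrm{End}(V)$ be a separable quadratic extension of $\mathbb{F}$. (a) Let $\mathcal{S}$ be an affine subspace of $\mathcal{A}^2(V)$ with translation vector space $W_{\mathbb{L}}$. Then there is a unique skew-Hermitian form $h$ on the $\mathbb{L}$-vector space $V^{\mathbb{L}}$ such that $$\forall s\in\mathcal{S},\ \forall x\in V,\ \forall\lambda\in\mathbb{L},\quad s(x,\lambda x)=\mathrm{tr}_{\mathbb{L}/\mathbb{F}}\bigl(h(x,\lambda x)\bigr).$$ (b) Conversely, for every skew-Hermitian form $h$ on the $\mathbb{L}$-vector space $V^{\mathbb{L}}$, the set of all $s\in\mathcal{A}^2(V)$ such that $s(x,\lambda x)=\mathrm{tr}_{\mathbb{L}/\mathbb{F}}(h(x,\lambda x))$ for all $x\in V$ and all $\lambda\in\mathbb{L}$ is an affine subspace of $\mathcal{A}^2(V)$ with translation vector space $W_{\mathbb{L}}$, and it is symplectic if and only if $h$ is nonisotropic. (c) Let $\mathbb{L}'\subset\mathrm{End}(V)$ be another quadratic extension of $\mathbb{F}$. Two affine subspaces $\mathcal{S}$ and $\mathcal{S}'$ of $\mathcal{A}^2(V)$ with respective translation vector spaces $W_{\mathbb{L}}$ and $W_{\mathbb{L}'}$ are congruent if and only if $\mathbb{L}'$ is isomorphic to $\mathbb{L}$ as an $\mathbb{F}$-algebra and the corresponding skew-Hermitian forms $h$ and $h'$ (given by (a)) are equivalent up to multiplication by $-1$.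
   Context: $\mathcal{A}^2(V)$ is the space of alternating bilinear forms on the $\mathbb{F}$-vector space $V$. A subset of $\mathcal{A}^2(V)$ is symplectic when all its elements are non-degenerate. Two subsets $\mathcal{S},\mathcal{S}'$ of $\mathcal{A}^2(V)$ are congruent when there is $\varphi\in\mathrm{GL}(V)$ with $\mathcal{S}'=\{(x,y)\mapsto s(\varphi^{-1}(x),\varphi^{-1}(y))\mid s\in\mathcal{S}\}$. A quadratic extension $\mathbb{L}\subset\mathrm{End}(V)$ of $\mathbb{F}$ is a subalgebra of $\mathrm{End}(V)$ containing $\mathbb{F}\,\mathrm{id}_V$ (identified with $\mathbb{F}$) that is a field of degree $2$ over $\mathbb{F}$. Then $V$ is naturally an $\mathbb{L}$-vector space, denoted $V^{\mathbb{L}}$, with $\lambda x:=\lambda(x)$. $W_{\mathbb{L}}$ is the linear subspace of all bilinear forms $s:V^2\to\mathbb{F}$ with $s(x,\lambda x)=0$ for all $x\in V$, $\lambda\in\mathbb{L}$ (it is included in $\mathcal{A}^2(V)$). For $\mathbb{L}$ separable over $\mathbb{F}$, let $\sigma$ be the non-identity element of $\mathrm{Gal}(\mathbb{L}/\mathbb{F})$. A skew-Hermitian form on an $\mathbb{L}$-vector space $U$ is a map $h:U\times U\to\mathbb{L}$ such that $h(x,-)$ is $\mathbb{L}$-linear for all $x\in U$ and $h(y,x)=-\sigma(h(x,y))$ for all $x,y\in U$. It is nonisotropic when $h(x,x)\neq0$ for all $x\in U\setminus\{0\}$. When $\mathbb{L}$ and $\mathbb{L}'$ are isomorphic, skew-Hermitian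 forms $h$ on $V^{\mathbb{L}}$ and $h'$ on $V^{\mathbb{L}'}$ are said to be equivalent up to multiplication by $-1$ when there are an $\mathbb{F}$-algebra isomorphism $\theta:\mathbb{L}\to\mathbb{L}'$, an additive bijection $\varphi:V\to V$ with $\varphi(\lambda x)=\theta(\lambda)\varphi(x)$ for all $\lambda\in\mathbb{L}$, $x\in V$, and a sign $\varepsilon\in\{1,-1\}$ such that $h'(\varphi(x),\varphi(y))=\varepsilon\,\theta(h(x,y))$ for all $x,y\in V$. *)

theory Defs
  imports "HOL-Library.Function_Algebras" "HOL-Library.FuncSet"
    "HOL-Computational_Algebra.Polynomial"
begin

text \<open>
  Throughout, \<open>V\<close> is the whole type \<open>'v\<close>, made an \<open>'f\<close>-vector space by \<open>scale\<close>.
  Sums, differences and zero of forms and of endomorphisms are the pointwise ones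
  of \<^theory>\<open>HOL-Library.Function_Algebras\<close>. The product of endomorphisms is \<open>\<circ>\<close>
  (never \<open>*\<close>, which would be pointwise), and the scalar \<open>c\<close> is identified with
  \<open>scale c\<close>, that is with \<open>c id\<close>.
\<close>

definition bilinear_form ::
  "('f::field \<Rightarrow> 'v::ab_group_add \<Rightarrow> 'v) \<Rightarrow> ('v \<Rightarrow> 'v \<Rightarrow> 'f) \<Rightarrow> bool" where
  "bilinear_form scale s \<longleftrightarrow>
     (\<forall>x. Vector_Spaces.linear scale (*) (s x)) \<and>
     (\<forall>y. Vector_Spaces.linear scale (*) (\<lambda>x. s x y))"

definition alt_forms ::
  "('f::field \<Rightarrow> 'v::ab_group_add \<Rightarrow> 'v) \<Rightarrow> ('v \<Rightarrow> 'v \<Rightarrow> 'f) set" where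
  "alt_forms scale = {s. bilinear_form scale s \<and> (\<forall>x. s x x = 0)}"

text \<open>For alternating forms the left and right radicals coincide.\<close>

definition nondegenerate :: "('v::ab_group_add \<Rightarrow> 'v \<Rightarrow> 'f::field) \<Rightarrow> bool" where
  "nondegenerate s \<longleftrightarrow> (\<forall>x. (\<forall>y. s x y = 0) \<longrightarrow> x = 0)"

definition symplectic :: "('v::ab_group_add \<Rightarrow> 'v \<Rightarrow> 'f::field) set \<Rightarrow> bool" where
  "symplectic S \<longleftrightarrow> (\<forall>s\<in>S. nondegenerate s)"

definition congruent_forms ::
  "('f::field \<Rightarrow> 'v::ab_group_add \<Rightarrow> 'v) \<Rightarrow> ('v \<Rightarrow> 'v \<Rightarrow> 'f) set \<Rightarrow> ('v \<Rightarrow> 'v \<Rightarrow> 'f) set \<Rightarrow> bool" where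
  "congruent_forms scale S S' \<longleftrightarrow>
     (\<exists>\<phi>. Vector_Spaces.linear scale scale \<phi> \<and> bij \<phi> \<and>
          S' = (\<lambda>s x y. s (inv \<phi> x) (inv \<phi> y)) ` S)"

definition form_scale :: "'f::field \<Rightarrow> ('v \<Rightarrow> 'v \<Rightarrow> 'f) \<Rightarrow> 'v \<Rightarrow> 'v \<Rightarrow> 'f" where
  "form_scale c s = (\<lambda>x y. c * s x y)"

text \<open>Affine subspaces are nonempty.\<close>

definition affine_alt_subspace ::
  "('f::field \<Rightarrow> 'v::ab_group_add \<Rightarrow> 'v) \<Rightarrow> ('v \<Rightarrow> 'v \<Rightarrow> 'f) set \<Rightarrow> ('v \<Rightarrow> 'v \<Rightarrow> 'f) set \<Rightarrow> bool" where
  "affine_alt_subspace scale S W \<longleftrightarrow>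
     W \<subseteq> alt_forms scale \<and> module.subspace form_scale W \<and>
     (\<exists>s0\<in>alt_forms scale. S = (\<lambda>w. s0 + w) ` W)"

definition end_scale ::
  "('f::field \<Rightarrow> 'v::ab_group_add \<Rightarrow> 'v) \<Rightarrow> 'f \<Rightarrow> ('v \<Rightarrow> 'v) \<Rightarrow> 'v \<Rightarrow> 'v" where
  "end_scale scale c f = (\<lambda>x. scale c (f x))"

definition quadratic_extension ::
  "('f::field \<Rightarrow> 'v::ab_group_add \<Rightarrow> 'v) \<Rightarrow> ('v \<Rightarrow> 'v) set \<Rightarrow> bool" where
  "quadratic_extension scale L \<longleftrightarrow>
     (\<forall>a\<in>L. Vector_Spaces.linear scale scale a) \<and>
     module.subspace (end_scale scale) L \<and>
     range scale \<subseteq> L \<and>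
     (\<forall>a\<in>L. \<forall>b\<in>L. a \<circ> b \<in> L) \<and>
     (\<forall>a\<in>L. \<forall>b\<in>L. a \<circ> b = b \<circ> a) \<and>
     (\<forall>a\<in>L. a \<noteq> 0 \<longrightarrow> (\<exists>b\<in>L. a \<circ> b = id)) \<and>
     vector_space.dim (end_scale scale) L = 2"

definition poly_end ::
  "('f::field \<Rightarrow> 'v::ab_group_add \<Rightarrow> 'v) \<Rightarrow> 'f poly \<Rightarrow> ('v \<Rightarrow> 'v) \<Rightarrow> 'v \<Rightarrow> 'v" where
  "poly_end scale p a = (\<Sum>i\<le>degree p. end_scale scale (coeff p i) (a ^^ i))"

text \<open>
  An irreducible polynomial vanishing at \<open>a\<close> is the minimal polynomial of \<open>a\<close>, up to a
  nonzero scalar; a polynomial is separable when it is coprime to its derivative.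
\<close>

definition separable_extension ::
  "('f::field \<Rightarrow> 'v::ab_group_add \<Rightarrow> 'v) \<Rightarrow> ('v \<Rightarrow> 'v) set \<Rightarrow> bool" where
  "separable_extension scale L \<longleftrightarrow>
     (\<forall>a\<in>L. \<exists>p. irreducible p \<and> poly_end scale p a = 0 \<and> coprime p (pderiv p))"

definition W_space ::
  "('f::field \<Rightarrow> 'v::ab_group_add \<Rightarrow> 'v) \<Rightarrow> ('v \<Rightarrow> 'v) set \<Rightarrow> ('v \<Rightarrow> 'v \<Rightarrow> 'f) set" where
  "W_space scale L = {s. bilinear_form scale s \<and> (\<forall>x. \<forall>a\<in>L. s x (a x) = 0)}"

definition alg_iso ::
  "('f::field \<Rightarrow> 'v::ab_group_add \<Rightarrow> 'v) \<Rightarrow> ('v \<Rightarrow> 'v) set \<Rightarrow> ('v \<Rightarrow> 'v) set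
    \<Rightarrow> (('v \<Rightarrow> 'v) \<Rightarrow> ('v \<Rightarrow> 'v)) \<Rightarrow> bool" where
  "alg_iso scale L L' \<theta> \<longleftrightarrow>
     bij_betw \<theta> L L' \<and>
     (\<forall>a\<in>L. \<forall>b\<in>L. \<theta> (a + b) = \<theta> a + \<theta> b \<and> \<theta> (a \<circ> b) = \<theta> a \<circ> \<theta> b) \<and>
     (\<forall>c. \<theta> (scale c) = scale c)"

text \<open>
  Automorphisms are taken extensional (\<open>undefined\<close> outside \<open>L\<close>), so that distinct
  elements of the Galois group are distinct functions.
\<close>

definition gal ::
  "('f::field \<Rightarrow> 'v::ab_group_add \<Rightarrow> 'v) \<Rightarrow> ('v \<Rightarrow> 'v) set \<Rightarrow> (('v \<Rightarrow> 'v) \<Rightarrow> ('v \<Rightarrow> 'v)) set" where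
  "gal scale L = {\<sigma> \<in> extensional L. alg_iso scale L L \<sigma>}"

definition conjugation ::
  "('f::field \<Rightarrow> 'v::ab_group_add \<Rightarrow> 'v) \<Rightarrow> ('v \<Rightarrow> 'v) set \<Rightarrow> ('v \<Rightarrow> 'v) \<Rightarrow> ('v \<Rightarrow> 'v)" where
  "conjugation scale L = (THE \<sigma>. \<sigma> \<in> gal scale L \<and> \<sigma> \<noteq> restrict id L)"

text \<open>
  The trace of \<open>a\<close> is that of the \<open>'f\<close>-linear map \<open>b \<mapsto> a \<circ> b\<close> of \<open>L\<close>, read off in any basis.
\<close>

definition ext_trace ::
  "('f::field \<Rightarrow> 'v::ab_group_add \<Rightarrow> 'v) \<Rightarrow> ('v \<Rightarrow> 'v) set \<Rightarrow> ('v \<Rightarrow> 'v) \<Rightarrow> 'f" where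
  "ext_trace scale L a =
     (let B = (SOME B. \<not> module.dependent (end_scale scale) B \<and>
                       module.span (end_scale scale) B = L)
      in \<Sum>b\<in>B. module.representation (end_scale scale) B (a \<circ> b) b)"

text \<open>The \<open>L\<close>-vector space structure of \<open>V\<close> is given by \<open>(a, x) \<mapsto> a x\<close>.\<close>

definition skew_hermitian ::
  "('f::field \<Rightarrow> 'v::ab_group_add \<Rightarrow> 'v) \<Rightarrow> ('v \<Rightarrow> 'v) set \<Rightarrow> ('v \<Rightarrow> 'v \<Rightarrow> ('v \<Rightarrow> 'v)) \<Rightarrow> bool" where
  "skew_hermitian scale L h \<longleftrightarrow>
     (\<forall>x y. h x y \<in> L) \<and>
     (\<forall>x y z. h x (y + z) = h x y + h x z) \<and>
     (\<forall>x y. \<forall>a\<in>L. h x (a y) = a \<circ> h x y) \<and>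
     (\<forall>x y. h y x = - conjugation scale L (h x y))"

definition nonisotropic :: "('v::ab_group_add \<Rightarrow> 'v \<Rightarrow> ('v \<Rightarrow> 'v)) \<Rightarrow> bool" where
  "nonisotropic h \<longleftrightarrow> (\<forall>x. x \<noteq> 0 \<longrightarrow> h x x \<noteq> 0)"

definition trace_compatible ::
  "('f::field \<Rightarrow> 'v::ab_group_add \<Rightarrow> 'v) \<Rightarrow> ('v \<Rightarrow> 'v) set \<Rightarrow> ('v \<Rightarrow> 'v \<Rightarrow> ('v \<Rightarrow> 'v))
    \<Rightarrow> ('v \<Rightarrow> 'v \<Rightarrow> 'f) \<Rightarrow> bool" where
  "trace_compatible scale L h s \<longleftrightarrow>
     (\<forall>x. \<forall>a\<in>L. s x (a x) = ext_trace scale L (h x (a x)))"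

text \<open>Meaningful only when \<open>L\<close> is separable, existence and uniqueness holding in that case.\<close>

definition assoc_form ::
  "('f::field \<Rightarrow> 'v::ab_group_add \<Rightarrow> 'v) \<Rightarrow> ('v \<Rightarrow> 'v) set \<Rightarrow> ('v \<Rightarrow> 'v \<Rightarrow> 'f) set
    \<Rightarrow> 'v \<Rightarrow> 'v \<Rightarrow> ('v \<Rightarrow> 'v)" where
  "assoc_form scale L S =
     (THE h. skew_hermitian scale L h \<and> (\<forall>s\<in>S. trace_compatible scale L h s))"

definition equivalent_up_to_sign ::
  "('f::field \<Rightarrow> 'v::ab_group_add \<Rightarrow> 'v) \<Rightarrow> ('v \<Rightarrow> 'v) set \<Rightarrow> ('v \<Rightarrow> 'v) set
    \<Rightarrow> ('v \<Rightarrow> 'v \<Rightarrow> ('v \<Rightarrow> 'v)) \<Rightarrow> ('v \<Rightarrow> 'v \<Rightarrow> ('v \<Rightarrow> 'v)) \<Rightarrow> bool" where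
  "equivalent_up_to_sign scale L L' h h' \<longleftrightarrow>
     (\<exists>\<theta> \<phi>. alg_iso scale L L' \<theta> \<and>
        bij \<phi> \<and> (\<forall>x y. \<phi> (x + y) = \<phi> x + \<phi> y) \<and>
        (\<forall>a\<in>L. \<forall>x. \<phi> (a x) = \<theta> a (\<phi> x)) \<and>
        ((\<forall>x y. h' (\<phi> x) (\<phi> y) = \<theta> (h x y)) \<or>
         (\<forall>x y. h' (\<phi> x) (\<phi> y) = - \<theta> (h x y))))"

end

theory Submission
  imports Defs
begin

text \<open>
  Write \<open>L = F(a)\<close> with \<open>a\<^sup>2 = t a - m\<close>; separability means that \<open>D = t\<^sup>2 - 4 m\<close> is nonzero.
  A skew-Hermitian form \<open>h\<close> is determined by its coefficient \<open>q\<close> along \<open>a\<close> in the basis \<open>1, a\<close>: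
  \<open>h(x,y) = (q(x,ay) - t q(x,y)) + q(x,y) a\<close>, where \<open>q\<close> ranges over the symmetric bilinear forms
  with \<open>q(ax,y) + q(x,ay) = t q(x,y)\<close>. An affine space over \<open>W\<^sub>L\<close> is the set of all alternating \<open>s\<close> with
  prescribed \<open>s(x,ax)\<close>, and polarizing this quadratic form gives \<open>s(x,ay) - s(ax,y) = D q(x,y)\<close>.
  If \<open>h(x,x) = 0\<close> with \<open>x \<noteq> 0\<close>, an explicit element of \<open>W\<^sub>L\<close> cancels the row \<open>s(x,-)\<close>.

  For the congruence statement, \<open>L\<close> is recovered from \<open>W\<^sub>L\<close> as the set of endomorphisms \<open>u\<close> with
  \<open>w(x,ux) = 0\<close> for all \<open>w \<in> W\<^sub>L\<close>, since there are at least two dimensions over \<open>L\<close>; so a congruence conjugates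
  \<open>L\<close> into \<open>L'\<close>. Conversely, the sign \<open>-1\<close> is absorbed by a semilinear involution \<open>\<psi>\<close> with
  \<open>h(\<psi>x,\<psi>y) = h(y,x) = -\<sigma>(h(x,y))\<close>, which is complex conjugation in the coordinates of an orthogonal basis.
\<close>

section \<open>Scalars, forms and endomorphisms as vector spaces; rules for bilinear forms\<close>

lemma vector_space_mult: "vector_space ((*) :: 'f::field \<Rightarrow> 'f \<Rightarrow> 'f)"
  by unfold_locales (simp_all add: algebra_simps)

lemma vector_space_form_scale:
  "vector_space (form_scale :: 'f::field \<Rightarrow> ('v \<Rightarrow> 'v \<Rightarrow> 'f) \<Rightarrow> _)"
  by unfold_locales (simp_all add: form_scale_def fun_eq_iff algebra_simps)

context vector_space
begin

lemma vector_space_end_scale: "vector_space (end_scale scale)"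
  by unfold_locales (simp_all add: end_scale_def fun_eq_iff algebra_simps)

lemma linear_iff_pointwise:
  "Vector_Spaces.linear scale (*) g \<longleftrightarrow>
    (\<forall>x y. g (x + y) = g x + g y) \<and> (\<forall>c x. g (c *s x) = c * g x)"
  by (simp add: Vector_Spaces.linear_iff vector_space_axioms vector_space_mult)

lemma linear_endo_iff:
  "Vector_Spaces.linear scale scale g \<longleftrightarrow>
    (\<forall>x y. g (x + y) = g x + g y) \<and> (\<forall>c x. g (c *s x) = c *s g x)"
  by (simp add: Vector_Spaces.linear_iff vector_space_axioms)

lemma bilinear_form_iff:
  "bilinear_form scale s \<longleftrightarrow>
    (\<forall>x y z. s x (y + z) = s x y + s x z) \<and> (\<forall>x c y. s x (c *s y) = c * s x y) \<and>
    (\<forall>x y z. s (x + y) z = s x z + s y z) \<and> (\<forall>x c y. s (c *s x) y = c * s x y)"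
  by (auto simp: bilinear_form_def linear_iff_pointwise)

lemma bilinear_form_simps:
  assumes "bilinear_form scale s"
  shows "s x (y + z) = s x y + s x z" "s x (c *s y) = c * s x y"
    "s (x + y) z = s x z + s y z" "s (c *s x) y = c * s x y"
    "s x (- y) = - s x y" "s (- x) y = - s x y"
    "s x (y - z) = s x y - s x z" "s (x - y) z = s x z - s y z"
    "s x 0 = 0" "s 0 y = 0"
proof -
  note b = assms[unfolded bilinear_form_iff]
  show 1: "s x (y + z) = s x y + s x z" "s x (c *s y) = c * s x y"
    "s (x + y) z = s x z + s y z" "s (c *s x) y = c * s x y" for x y z c
    using b by auto
  show n: "s x (- y) = - s x y" "s (- x) y = - s x y" for x y
    using 1(2)[of x "-1" y] 1(4)[of "-1" x y] by simp_all
  show "s x (y - z) = s x y - s x z" "s (x - y) z = s x z - s y z"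
    using 1(1)[of x y "- z"] 1(3)[of x "- y" z] by (simp_all add: n)
  show "s x 0 = 0" "s 0 y = 0"
    using 1(2)[of x 0 y] 1(4)[of 0 x y] by simp_all
qed

lemma alt_form_skew:
  assumes "s \<in> alt_forms scale"
  shows "s y x = - s x y"
proof -
  have b: "bilinear_form scale s" and z: "\<And>x. s x x = 0"
    using assms by (auto simp: alt_forms_def)
  have "s x y + s y x = 0"
    using z[of "x + y"] z[of x] z[of y] by (simp add: bilinear_form_simps[OF b] add.commute)
  then show ?thesis
    by (simp add: eq_neg_iff_add_eq_0 add.commute)
qed

section \<open>A quadratic extension as a two-dimensional space of endomorphisms\<close>

lemma subspace_two_dim_eq_span:
  assumes "subspace U" "dim U = 2" "x \<in> U" "y \<in> U" "x \<noteq> y" "independent {x, y}"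
  shows "U = span {x, y}"
proof
  obtain B where B: "B \<subseteq> U" "independent B" "U \<subseteq> span B" "card B = 2"
    using basis_exists[of U] assms(2) by metis
  have "finite B"
    using B(4) card.infinite by fastforce
  show "U \<subseteq> span {x, y}"
  proof (rule subsetI, rule ccontr)
    fix u assume u: "u \<in> U" "u \<notin> span {x, y}"
    then have "independent {u, x, y}" "u \<noteq> x" "u \<noteq> y"
      using independent_insertI[OF u(2) assms(6)] by (auto intro: span_base)
    moreover have "{u, x, y} \<subseteq> span B"
      using assms(3,4) u(1) B(3) by auto
    ultimately show False
      using independent_span_bound[OF \<open>finite B\<close>, of "{u, x, y}"] assms(5) B(4) by simp
  qed
  show "span {x, y} \<subseteq> U"
    using assms by (intro span_minimal) auto
qed

text \<open>As \<open>a\<close> is not a scalar, \<open>id\<close> and \<open>a\<close> are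
  independent, hence a basis of the two-dimensional space \<open>L\<close>.\<close>

lemma quadratic_extension_elem:
  assumes "quadratic_extension scale L" "a \<in> L" "a \<notin> range scale" "b \<in> L"
  shows "\<exists>\<alpha> \<beta>. b = (\<lambda>x. \<alpha> *s x + \<beta> *s a x)"
proof -
  interpret E: vector_space "end_scale scale"
    by (rule vector_space_end_scale)
  have sub: "E.subspace L" "E.dim L = 2" "range scale \<subseteq> L"
    using assms(1) by (simp_all add: quadratic_extension_def)
  have id: "id = scale 1"
    by (simp add: fun_eq_iff)
  then have "id \<noteq> a" "id \<in> L"
    using assms(3) sub(3) by auto
  moreover have "E.independent {id, a}"
  proof -
    \<comment> \<open>On the zero space every endomorphism would be \<open>scale 0\<close>, so
      \<open>a\<close> would be a scalar.\<close>
    have "(id :: 'b \<Rightarrow> 'b) \<noteq> 0"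
    proof
      assume "(id :: 'b \<Rightarrow> 'b) = 0"
      then have "x = 0" for x :: 'b
        by (metis id_apply zero_fun_apply)
      then have "a = scale 0"
        by (simp add: fun_eq_iff)
      then show False
        using assms(3) by auto
    qed
    moreover have "a \<noteq> end_scale scale k id" for k
      using assms(3) by (auto simp: end_scale_def fun_eq_iff)
    ultimately have "E.independent {a, id}"
      using E.independent_insert[of a "{id}"] E.span_breakdown_eq[of a id "{}"]
      by (auto simp: E.span_empty E.dependent_single)
    then show ?thesis
      by (simp add: insert_commute)
  qed
  ultimately have "b \<in> E.span {id, a}"
    using E.subspace_two_dim_eq_span sub assms(2,4) by blast
  then obtain k l where "b - end_scale scale k id - end_scale scale l a \<in> E.span {}"
    by (metis E.span_breakdown_eq)
  then have "b = end_scale scale k id + end_scale scale l a"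
    by (simp add: algebra_simps)
  then have "b = (\<lambda>x. k *s x + l *s a x)"
    by (simp add: end_scale_def fun_eq_iff)
  then show ?thesis by blast
qed

text \<open>The scalars span only a line, whereas \<open>L\<close> has dimension 2.\<close>

lemma quadratic_extension_not_scalar:
  assumes "quadratic_extension scale L"
  obtains a where "a \<in> L" "a \<notin> range scale"
proof -
  interpret E: vector_space "end_scale scale"
    by (rule vector_space_end_scale)
  have "\<not> L \<subseteq> range scale"
  proof
    assume "L \<subseteq> range scale"
    have "scale c = end_scale scale c id" for c
      by (simp add: end_scale_def fun_eq_iff)
    then have "L \<subseteq> E.span {id}"
      using \<open>L \<subseteq> range scale\<close> E.span_scale[OF E.span_base, of id "{id}"] by fastforce
    moreover obtain B where "B \<subseteq> L" "E.independent B" "card B = E.dim L"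
      using E.basis_exists by metis
    ultimately have "E.dim L \<le> 1"
      using E.independent_span_bound[of "{id}" B] by simp
    then show False
      using assms by (simp add: quadratic_extension_def)
  qed
  then show ?thesis
    using that by blast
qed

end

text \<open>The discriminant is a combination of \<open>t\<close> and 2, so these cannot both
  annihilate a nonzero scalar. This keeps the later arguments uniform in the characteristic.\<close>

lemma eq_zero_of_two_mult:
  fixes D t m r :: "'f::field"
  assumes "2 * r = 0" "t * r = 0" "t * t - 4 * m \<noteq> 0"
  shows "r = 0"
proof -
  have "(t * t - 4 * m) * r = t * (t * r) - 2 * m * (2 * r)"
    by (simp add: algebra_simps)
  then show ?thesis
    using assms by simp
qed

section \<open>Coordinates of \<open>L\<close> in the basis 1, \<open>a\<close>: products, norm and
  trace\<close>

locale quadratic_generator = vector_space scale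
  for scale :: "'f::field \<Rightarrow> 'v::ab_group_add \<Rightarrow> 'v" (infixr \<open>*s\<close> 75) +
  fixes L :: "('v \<Rightarrow> 'v) set" and a :: "'v \<Rightarrow> 'v" and t m :: 'f
  assumes quadratic: "quadratic_extension scale L"
    and generator: "a \<in> L" "a \<notin> range scale"
    and square: "a (a x) = t *s a x - m *s x"
begin

interpretation E: vector_space "end_scale scale"
  by (rule vector_space_end_scale)

text \<open>The element \<alpha> + \<beta> a of \<open>L\<close>; identities in \<open>L\<close>
  become identities between pairs of scalars.\<close>

definition elem :: "'f \<Rightarrow> 'f \<Rightarrow> 'v \<Rightarrow> 'v" where
  "elem \<alpha> \<beta> = (\<lambda>x. \<alpha> *s x + \<beta> *s a x)"

lemma L_linear: "b \<in> L \<Longrightarrow> b (x + y) = b x + b y" "b \<in> L \<Longrightarrow> b (c *s x) = c *s b x"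
  using quadratic by (auto simp: quadratic_extension_def linear_endo_iff)

lemma generator_simps:
  "a (x + y) = a x + a y" "a (c *s x) = c *s a x" "a (- x) = - a x" "a (x - y) = a x - a y" "a 0 = 0"
proof -
  show 1: "a (x + y) = a x + a y" "a (c *s x) = c *s a x" for x y c
    using L_linear generator(1) by auto
  show "a (- x) = - a x" for x
    using 1(2)[of "-1" x] by simp
  then show "a (x - y) = a x - a y"
    using 1(1)[of x "- y"] by simp
  show "a 0 = 0"
    using 1(2)[of 0 0] by simp
qed

lemma elem_comp:
  "elem \<alpha> \<beta> \<circ> elem \<gamma> \<epsilon> = elem (\<alpha> * \<gamma> - m * \<beta> * \<epsilon>) (\<alpha> * \<epsilon> + \<beta> * \<gamma> + t * \<beta> * \<epsilon>)"
  by (simp add: elem_def fun_eq_iff generator_simps square algebra_simps)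

lemma elem_add: "elem \<alpha> \<beta> + elem \<gamma> \<epsilon> = elem (\<alpha> + \<gamma>) (\<beta> + \<epsilon>)"
  by (simp add: elem_def fun_eq_iff algebra_simps)

lemma elem_uminus: "- elem \<alpha> \<beta> = elem (- \<alpha>) (- \<beta>)"
  by (simp add: elem_def fun_eq_iff)

lemma elem_scale: "end_scale scale c (elem \<alpha> \<beta>) = elem (c * \<alpha>) (c * \<beta>)"
  by (simp add: elem_def end_scale_def fun_eq_iff algebra_simps)

lemma elem_base: "elem \<alpha> 0 = scale \<alpha>" "elem 0 1 = a" "elem 1 0 = id" "elem 0 0 = 0"
  by (simp_all add: elem_def fun_eq_iff)

lemma subspace_L: "E.subspace L"
  using quadratic by (simp add: quadratic_extension_def)

lemma dim_L: "E.dim L = 2"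
  using quadratic by (simp add: quadratic_extension_def)

lemma elem_in_L: "elem \<alpha> \<beta> \<in> L"
proof -
  have "scale \<alpha> \<in> L"
    using quadratic by (auto simp: quadratic_extension_def)
  moreover have "end_scale scale \<beta> a \<in> L"
    using subspace_L generator(1) E.subspace_scale by blast
  ultimately have "scale \<alpha> + end_scale scale \<beta> a \<in> L"
    using subspace_L E.subspace_add by blast
  then show ?thesis
    by (simp add: elem_def end_scale_def plus_fun_def)
qed

text \<open>A nonzero \<beta> would express \<open>a\<close> as a scalar; after that, a nonzero
  \<alpha> would force V = 0, where \<open>a = scale 0\<close>.\<close>

lemma elem_eq_0_iff: "elem \<alpha> \<beta> = 0 \<longleftrightarrow> \<alpha> = 0 \<and> \<beta> = 0"
proof
  assume *: "elem \<alpha> \<beta> = 0"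
  have "\<beta> = 0"
  proof (rule ccontr)
    assume "\<beta> \<noteq> 0"
    have "a x = (- \<alpha> / \<beta>) *s x" for x :: 'v
    proof -
      have "\<beta> *s a x = - (\<alpha> *s x)"
        using fun_cong[OF *, of x] by (simp add: elem_def eq_neg_iff_add_eq_0 add.commute)
      then have "inverse \<beta> *s (\<beta> *s a x) = inverse \<beta> *s (- (\<alpha> *s x))"
        by simp
      then show ?thesis
        using \<open>\<beta> \<noteq> 0\<close> by (simp add: field_simps)
    qed
    then have "a = scale (- \<alpha> / \<beta>)" by auto
    then show False using generator(2) by auto
  qed
  moreover have "\<alpha> = 0"
  proof (rule ccontr)
    assume "\<alpha> \<noteq> 0"
    then have "x = 0" for x :: 'v
      using fun_cong[OF *, of x] \<open>\<beta> = 0\<close> by (simp add: elem_def)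
    then have "a = scale 0" by (auto simp: fun_eq_iff)
    then show False using generator(2) by auto
  qed
  ultimately show "\<alpha> = 0 \<and> \<beta> = 0" by simp
qed (simp add: elem_def fun_eq_iff)

lemma elem_eq_iff: "elem \<alpha> \<beta> = elem \<gamma> \<epsilon> \<longleftrightarrow> \<alpha> = \<gamma> \<and> \<beta> = \<epsilon>"
proof
  assume "elem \<alpha> \<beta> = elem \<gamma> \<epsilon>"
  then have "elem \<alpha> \<beta> + - elem \<gamma> \<epsilon> = 0"
    by (simp add: fun_eq_iff)
  then show "\<alpha> = \<gamma> \<and> \<beta> = \<epsilon>"
    by (simp add: elem_uminus elem_add elem_eq_0_iff)
qed simp

lemma L_eq: "L = range (\<lambda>(\<alpha>, \<beta>). elem \<alpha> \<beta>)"
  using quadratic_extension_elem[OF quadratic generator] elem_in_L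
  by (fastforce simp: elem_def)

lemma L_cases:
  assumes "b \<in> L"
  obtains \<alpha> \<beta> where "b = elem \<alpha> \<beta>"
  using assms L_eq by auto

lemma L_comm: "b \<in> L \<Longrightarrow> c \<in> L \<Longrightarrow> b \<circ> c = c \<circ> b"
  using quadratic unfolding quadratic_extension_def by blast

lemma L_inj:
  assumes "b \<in> L" "b \<noteq> 0" "b x = 0"
  shows "x = 0"
proof -
  obtain c where "c \<in> L" "b \<circ> c = id"
    using quadratic assms unfolding quadratic_extension_def by blast
  then have "c \<circ> b = id"
    using L_comm[OF assms(1) \<open>c \<in> L\<close>] by metis
  then have "c (b x) = x"
    by (simp add: fun_eq_iff)
  then show ?thesis
    using assms(3) L_linear(2)[OF \<open>c \<in> L\<close>, of 0 0] by simp
qed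

lemma elem_inj: "elem \<alpha> \<beta> x = 0 \<Longrightarrow> x \<noteq> 0 \<Longrightarrow> \<alpha> = 0 \<and> \<beta> = 0"
  using L_inj[OF elem_in_L] elem_eq_0_iff by blast

lemma exists_nonzero: "\<exists>x. (x::'v) \<noteq> 0"
  using elem_eq_0_iff[of 1 0] by (auto simp: elem_def fun_eq_iff)

text \<open>The expression is the norm of \<alpha> + \<beta> a, its product with the conjugate
  \<alpha> + t \<beta> - \<beta> a, and a field has no zero divisors.\<close>

lemma norm_nonzero:
  assumes "\<alpha> * \<alpha> + t * \<alpha> * \<beta> + m * \<beta> * \<beta> = 0"
  shows "\<alpha> = 0 \<and> \<beta> = 0"
proof -
  have "elem \<alpha> \<beta> \<circ> elem (\<alpha> + t * \<beta>) (- \<beta>) = 0"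
    using assms by (simp add: elem_comp elem_eq_0_iff algebra_simps)
  then have *: "elem \<alpha> \<beta> (elem (\<alpha> + t * \<beta>) (- \<beta>) x) = 0" for x
    by (metis comp_apply zero_fun_apply)
  obtain x :: 'v where "x \<noteq> 0"
    using exists_nonzero by blast
  then show ?thesis
    using elem_inj[OF *[of x]] elem_inj[of "\<alpha> + t * \<beta>" "- \<beta>" x]
    by (cases "elem (\<alpha> + t * \<beta>) (- \<beta>) x = 0") auto
qed

text \<open>The trace is defined through an arbitrarily chosen basis \<open>b\<close>,
  \<open>c\<close>, so the matrix of multiplication in that basis has to be compared with the one in
  the basis 1, \<open>a\<close>.\<close>

lemma ext_trace_elem: "ext_trace scale L (elem \<gamma> \<epsilon>) = 2 * \<gamma> + t * \<epsilon>"
proof -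
  define B where "B = (SOME B. E.independent B \<and> E.span B = L)"
  have "\<exists>B. E.independent B \<and> E.span B = L"
    using E.basis_exists[of L] subspace_L by (metis E.span_subspace)
  then have B: "E.independent B" "E.span B = L"
    unfolding B_def by (metis (mono_tags, lifting) someI_ex)+
  have "card B = 2"
    using E.dim_eq_card[of B L] B E.span_eq_iff subspace_L dim_L by metis
  then obtain b c where bc: "B = {b, c}" "b \<noteq> c"
    by (meson card_2_iff)
  obtain p q where b: "b = elem p q"
    using L_cases E.span_base[of b B] B(2) bc by blast
  obtain p' q' where c: "c = elem p' q'"
    using L_cases E.span_base[of c B] B(2) bc by blast
  have rep: "u = end_scale scale (E.representation B u b) b + end_scale scale (E.representation B u c) c"
    if "u \<in> L" for u
    using E.sum_representation_eq[of B u B] B that bc by simp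
  have indep: "k = 0 \<and> l = 0" if "end_scale scale k b + end_scale scale l c = 0" for k l
    using E.independentD[OF B(1), of B "\<lambda>x. if x = b then k else l" b]
      E.independentD[OF B(1), of B "\<lambda>x. if x = b then k else l" c] that bc
    by simp
  let ?e = "elem \<gamma> \<epsilon>"
  define r1 r2 r3 r4 where "r1 = E.representation B (?e \<circ> b) b" "r2 = E.representation B (?e \<circ> b) c"
    "r3 = E.representation B (?e \<circ> c) b" "r4 = E.representation B (?e \<circ> c) c"
  note r = r1_r2_r3_r4_def
  have "?e \<circ> b = end_scale scale r1 b + end_scale scale r2 c"
    "?e \<circ> c = end_scale scale r3 b + end_scale scale r4 c"
    unfolding r by (rule rep, simp add: b c elem_comp elem_in_L)+
  then have e: "\<gamma> * p - m * \<epsilon> * q = r1 * p + r2 * p'" "\<gamma> * q + \<epsilon> * p + t * \<epsilon> * q = r1 * q + r2 * q'"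
    "\<gamma> * p' - m * \<epsilon> * q' = r3 * p + r4 * p'" "\<gamma> * q' + \<epsilon> * p' + t * \<epsilon> * q' = r3 * q + r4 * q'"
    by (simp_all add: b c elem_comp elem_scale elem_add elem_eq_iff)
  have det: "p * q' - p' * q \<noteq> 0"
  proof
    assume "p * q' - p' * q = 0"
    then have "end_scale scale q' b + end_scale scale (- q) c = 0"
      "end_scale scale p' b + end_scale scale (- p) c = 0"
      by (simp_all add: b c elem_scale elem_add elem_eq_0_iff algebra_simps)
    then have "q' = 0 \<and> q = 0" "p' = 0 \<and> p = 0"
      using indep by fastforce+
    then show False
      using b c bc(2) by simp
  qed
  \<comment> \<open>Eliminating from the four coordinate equations gives invariance of the trace
    under change of basis, multiplied by the determinant of that change.\<close>
  have "(2 * \<gamma> + t * \<epsilon>) * (p * q' - p' * q) = (r1 + r4) * (p * q' - p' * q)"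
    using e by algebra
  then have "2 * \<gamma> + t * \<epsilon> = r1 + r4"
    using det by simp
  moreover have "ext_trace scale L ?e = r1 + r4"
    using bc by (simp add: ext_trace_def B_def[symmetric] r Let_def)
  ultimately show ?thesis by simp
qed

end

section \<open>The nontrivial automorphism of \<open>L\<close>\<close>

locale separable_generator = quadratic_generator scale L a t m
  for scale :: "'f::field \<Rightarrow> 'v::ab_group_add \<Rightarrow> 'v" (infixr \<open>*s\<close> 75) and L a t m +
  assumes discriminant: "t * t - 4 * m \<noteq> 0"
begin

lemma conjugation_elem: "conjugation scale L (elem \<alpha> \<beta>) = elem (\<alpha> + t * \<beta>) (- \<beta>)"
proof -
  \<comment> \<open>The definite description reads off the coordinates; the value
    \<open>undefined\<close> outside \<open>L\<close> makes \<open>\<tau>\<close> extensional, as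
    \<open>gal\<close> demands.\<close>
  define \<tau> where "\<tau> = (\<lambda>b. if b \<in> L then (THE c. \<exists>\<alpha> \<beta>. b = elem \<alpha> \<beta> \<and> c = elem (\<alpha> + t * \<beta>) (- \<beta>)) else undefined)"
  have \<tau>: "\<tau> (elem \<alpha> \<beta>) = elem (\<alpha> + t * \<beta>) (- \<beta>)" for \<alpha> \<beta>
    by (auto simp: \<tau>_def elem_in_L elem_eq_iff)
  have \<tau>_L: "\<tau> b \<in> L" "\<tau> (\<tau> b) = b" if "b \<in> L" for b
    using that by (auto elim!: L_cases simp: \<tau> elem_in_L)
  have bij: "bij_betw \<tau> L L"
    using \<tau>_L by (intro bij_betwI[where g = \<tau>]) auto
  have "\<tau> (b + c) = \<tau> b + \<tau> c \<and> \<tau> (b \<circ> c) = \<tau> b \<circ> \<tau> c" if "b \<in> L" "c \<in> L" for b c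
    using that by (auto elim!: L_cases simp: \<tau> elem_add elem_comp elem_eq_iff algebra_simps)
  moreover have "\<tau> (scale c) = scale c" for c
    using \<tau>[of c 0] by (simp add: elem_base)
  ultimately have gal: "\<tau> \<in> gal scale L"
    using bij by (auto simp: gal_def alg_iso_def \<tau>_def extensional_def)
  \<comment> \<open>If \<open>\<tau>\<close> fixed \<open>a\<close>, then \<open>t = 0\<close> and
    the characteristic would be 2, so the discriminant would vanish.\<close>
  have ne: "\<tau> \<noteq> restrict id L"
  proof
    assume "\<tau> = restrict id L"
    then have "\<tau> (elem 0 1) = elem 0 1"
      using elem_in_L by simp
    then have "t = 0" "-1 = (1::'f)"
      using \<tau>[of 0 1] by (simp_all add: elem_eq_iff)
    then have "2 = (0::'f)"
      by (metis add.right_inverse one_add_one)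
    then have "t * t - 4 * m = 0"
      using \<open>t = 0\<close> by (metis diff_self mult_2 mult_zero_left numeral_Bit0 add_0)
    then show False using discriminant by simp
  qed
  have "\<sigma> = \<tau>" if \<sigma>: "\<sigma> \<in> gal scale L" "\<sigma> \<noteq> restrict id L" for \<sigma>
  proof -
    have ext: "\<sigma> \<in> extensional L" and bij: "bij_betw \<sigma> L L"
      and hom: "\<And>b c. b \<in> L \<Longrightarrow> c \<in> L \<Longrightarrow> \<sigma> (b + c) = \<sigma> b + \<sigma> c \<and> \<sigma> (b \<circ> c) = \<sigma> b \<circ> \<sigma> c"
      and sc: "\<And>c. \<sigma> (scale c) = scale c"
      using \<sigma>(1) by (auto simp: gal_def alg_iso_def)
    have "\<sigma> a \<in> L"
      using bij generator(1) by (auto dest: bij_betwE)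
    then obtain \<gamma> \<epsilon> where ge: "\<sigma> a = elem \<gamma> \<epsilon>"
      by (rule L_cases)
    have \<sigma>_elem: "\<sigma> (elem \<alpha> \<beta>) = elem (\<alpha> + \<beta> * \<gamma>) (\<beta> * \<epsilon>)" for \<alpha> \<beta>
    proof -
      have "elem \<alpha> \<beta> = elem \<alpha> 0 + (elem \<beta> 0 \<circ> elem 0 1)"
        by (simp add: elem_comp elem_add)
      then have "\<sigma> (elem \<alpha> \<beta>) = elem \<alpha> 0 + (elem \<beta> 0 \<circ> \<sigma> a)"
        using hom[of "elem \<alpha> 0" "elem \<beta> 0 \<circ> elem 0 1"] hom[of "elem \<beta> 0" "elem 0 1"] sc
        by (simp add: elem_in_L elem_comp) (simp add: elem_base)
      then show ?thesis
        by (simp add: ge elem_comp elem_add)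
    qed
    have "\<sigma> (elem 0 1 \<circ> elem 0 1) = \<sigma> (elem 0 1) \<circ> \<sigma> (elem 0 1)"
      using hom elem_in_L by blast
    then have eq: "\<gamma> * \<gamma> - m * \<epsilon> * \<epsilon> = - m + t * \<gamma>" "2 * \<gamma> * \<epsilon> + t * \<epsilon> * \<epsilon> = t * \<epsilon>"
      by (simp_all add: elem_comp \<sigma>_elem elem_eq_iff algebra_simps)
    \<comment> \<open>The image \<open>\<sigma> a\<close> is a root of \<open>X^2 - t X + m\<close>.
      The two factors are \<open>\<sigma> a\<close> minus \<open>a\<close> and
      \<open>\<sigma> a\<close> minus the conjugate t - a.\<close>
    have "elem \<gamma> (\<epsilon> - 1) \<circ> elem (\<gamma> - t) (\<epsilon> + 1) = 0"
      using eq by (simp add: elem_comp elem_eq_0_iff algebra_simps)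
    then have "elem \<gamma> (\<epsilon> - 1) (elem (\<gamma> - t) (\<epsilon> + 1) x) = 0" for x
      by (metis comp_apply zero_fun_apply)
    moreover obtain x :: 'v where "x \<noteq> 0"
      using exists_nonzero by blast
    ultimately have "(\<gamma> = 0 \<and> \<epsilon> = 1) \<or> (\<gamma> = t \<and> \<epsilon> = - 1)"
      using elem_inj[of \<gamma> "\<epsilon> - 1"] elem_inj[of "\<gamma> - t" "\<epsilon> + 1" x]
      by (metis eq_iff_diff_eq_0 eq_neg_iff_add_eq_0)
    then show ?thesis
    proof
      assume "\<gamma> = 0 \<and> \<epsilon> = 1"
      then have "\<sigma> = restrict id L"
        using ext \<sigma>_elem by (auto simp: extensional_def fun_eq_iff restrict_def elim!: L_cases)
      then show ?thesis using \<sigma>(2) by simp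
    next
      assume "\<gamma> = t \<and> \<epsilon> = - 1"
      then have "\<sigma> b = \<tau> b" if "b \<in> L" for b
        using that by (auto elim!: L_cases simp: \<sigma>_elem \<tau> mult.commute)
      then show ?thesis
        using ext by (auto simp: extensional_def \<tau>_def fun_eq_iff)
    qed
  qed
  then have "conjugation scale L = \<tau>"
    unfolding conjugation_def using gal ne by (blast intro: the_equality)
  then show ?thesis by (simp add: \<tau>)
qed

end

section \<open>Polynomials in the generator; separability as a nonzero discriminant\<close>

lemma sum_fun_eval: "(\<Sum>i\<in>A. f i) x = (\<Sum>i\<in>A. f i x :: 'b::comm_monoid_add)"
  by (induction A rule: infinite_finite_induct) auto

context quadratic_generator
begin

lemma id_in_L: "id \<in> L"
  using elem_in_L[of 1 0] elem_base(3) by simp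

lemma poly_end_eval:
  assumes "degree p \<le> n"
  shows "poly_end scale p a x = (\<Sum>i\<le>n. coeff p i *s (a ^^ i) x)"
proof -
  have "(\<Sum>i\<le>degree p. coeff p i *s (a ^^ i) x) = (\<Sum>i\<le>n. coeff p i *s (a ^^ i) x)"
    using assms by (intro sum.mono_neutral_left) (auto simp: coeff_eq_0)
  then show ?thesis
    by (simp add: poly_end_def sum_fun_eval end_scale_def)
qed

lemma generator_sum: "a (\<Sum>i\<in>A. f i) = (\<Sum>i\<in>A. a (f i))"
  by (induction A rule: infinite_finite_induct) (auto simp: generator_simps)

lemma poly_end_pCons: "poly_end scale (pCons c p) a x = c *s x + a (poly_end scale p a x)"
proof -
  have "poly_end scale (pCons c p) a x = (\<Sum>i\<le>Suc (degree p). coeff (pCons c p) i *s (a ^^ i) x)"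
    by (intro poly_end_eval) (simp add: degree_pCons_le)
  also have "\<dots> = c *s x + (\<Sum>i\<le>degree p. coeff p i *s a ((a ^^ i) x))"
    by (simp only: sum.atMost_Suc_shift) simp
  finally show ?thesis
    by (simp add: poly_end_eval[OF order_refl] generator_sum generator_simps)
qed

text \<open>Division by the polynomial \<open>X^2 - t X + m\<close>, which vanishes at
  \<open>a\<close>: the value of \<open>p\<close> at \<open>a\<close> is that of the
  remainder.\<close>

lemma poly_end_division:
  "\<exists>r \<alpha> \<beta>. p = [:m, - t, 1:] * r + [:\<alpha>, \<beta>:] \<and> poly_end scale p a = elem \<alpha> \<beta>"
proof (induction p)
  case 0
  have "poly_end scale 0 a = elem 0 0"
    by (simp add: poly_end_def end_scale_def elem_def fun_eq_iff sum_fun_eval)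
  then show ?case
    by (intro exI[of _ 0]) simp
next
  case (pCons c p)
  then obtain r \<alpha> \<beta> where p: "p = [:m, - t, 1:] * r + [:\<alpha>, \<beta>:]" "poly_end scale p a = elem \<alpha> \<beta>"
    by blast
  have "pCons c p = [:c:] + [:0, 1:] * p"
    by simp
  also have "\<dots> = [:m, - t, 1:] * ([:0, 1:] * r + [:\<beta>:]) + [:c - \<beta> * m, \<alpha> + \<beta> * t:]"
    unfolding p(1) by (simp add: algebra_simps)
  finally have "pCons c p = \<dots>" .
  moreover have "poly_end scale (pCons c p) a = elem (c - \<beta> * m) (\<alpha> + \<beta> * t)"
    by (simp add: fun_eq_iff poly_end_pCons p(2)) (simp add: elem_def generator_simps square algebra_simps)
  ultimately show ?case by blast
qed

text \<open>With zero discriminant, \<open>a\<close> would be the scalar \<open>t / 2\<close>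
  outside characteristic 2. In characteristic 2 it gives \<open>t = 0\<close>, and the minimal
  polynomial \<open>X^2 + m\<close> has zero derivative.\<close>

lemma separable_discriminant:
  assumes "separable_extension scale L"
  shows "t * t - 4 * m \<noteq> 0"
proof
  assume disc: "t * t - 4 * m = 0"
  show False
  proof (cases "2 = (0::'f)")
    case False
    have "(2::'f) * 2 \<noteq> 0"
      using False by (metis mult_eq_0_iff)
    then have "4 \<noteq> (0::'f)" by simp
    have "(- t / 2) * (- t / 2) + t * (- t / 2) * 1 + m * 1 * 1 = 0"
      using disc False \<open>4 \<noteq> 0\<close> by (simp add: field_simps)
    then show False
      using norm_nonzero[of "- t / 2" 1] by simp
  next
    case True
    have "(4::'f) = 2 * 2" by simp
    then have "t = 0"
      using True disc by simp
    obtain p where p: "irreducible p" "poly_end scale p a = 0" "coprime p (pderiv p)"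
      using assms generator(1) by (auto simp: separable_extension_def)
    obtain r \<alpha> \<beta> where r: "p = [:m, - t, 1:] * r + [:\<alpha>, \<beta>:]" "poly_end scale p a = elem \<alpha> \<beta>"
      using poly_end_division by blast
    \<comment> \<open>The remainder vanishes, so the irreducible \<open>p\<close> is a scalar
      multiple of \<open>X^2 - t X + m\<close>.\<close>
    then have pr: "p = [:m, - t, 1:] * r"
      using p(2) elem_eq_0_iff by simp
    have "\<not> [:m, - t, 1:] dvd 1"
      by (simp add: is_unit_iff_degree)
    then have "r dvd 1"
      using p(1) pr by (metis irreducible_def)
    then obtain c where "r = [:c:]"
      by (auto simp: is_unit_poly_iff)
    then have "pderiv p = 0"
      using True \<open>t = 0\<close> by (simp add: pr pderiv_pCons)
    then show False
      using p(1,3) by (auto simp: irreducible_def)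
  qed
qed

end

lemma (in vector_space) separable_generator_exists:
  assumes "quadratic_extension scale L" "separable_extension scale L"
  obtains a t m where "separable_generator scale L a t m"
proof -
  obtain a where a: "a \<in> L" "a \<notin> range scale"
    using quadratic_extension_not_scalar assms(1) by blast
  have "a \<circ> a \<in> L"
    using assms(1) a(1) by (simp add: quadratic_extension_def)
  then obtain k l where "a \<circ> a = (\<lambda>x. k *s x + l *s a x)"
    using quadratic_extension_elem[OF assms(1) a] by blast
  then have "a (a x) = l *s a x - (- k) *s x" for x
    by (simp add: fun_eq_iff)
  then interpret quadratic_generator scale L a l "- k"
    using assms(1) a by unfold_locales auto
  show ?thesis
    using that separable_discriminant[OF assms(2)]
    by (metis quadratic_generator_axioms separable_generator.intro separable_generator_axioms.intro)
qed

section \<open>Skew-Hermitian forms through their coefficient along \<open>a\<close>\<close>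

context separable_generator
begin

text \<open>By linearity in \<lambda>, the condition s(x, \<lambda> x) = 0 need only be tested on
  the basis 1, \<open>a\<close> of \<open>L\<close>.\<close>

lemma W_space_iff: "s \<in> W_space scale L \<longleftrightarrow> s \<in> alt_forms scale \<and> (\<forall>x. s x (a x) = 0)"
proof
  assume "s \<in> W_space scale L"
  then show "s \<in> alt_forms scale \<and> (\<forall>x. s x (a x) = 0)"
    using id_in_L generator(1) by (force simp: W_space_def alt_forms_def)
next
  assume s: "s \<in> alt_forms scale \<and> (\<forall>x. s x (a x) = 0)"
  then have "bilinear_form scale s" by (simp add: alt_forms_def)
  with s show "s \<in> W_space scale L"
    by (auto simp: W_space_def alt_forms_def elem_def bilinear_form_simps elim!: L_cases)
qed

text \<open>The last clause says that the adjoint of \<open>a\<close> with respect to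
  \<open>q\<close> is its conjugate t - a.\<close>

definition skew_coeff :: "('v \<Rightarrow> 'v \<Rightarrow> 'f) \<Rightarrow> bool" where
  "skew_coeff q \<longleftrightarrow> bilinear_form scale q \<and> (\<forall>x y. q y x = q x y) \<and>
     (\<forall>x y. q (a x) y + q x (a y) = t * q x y)"

text \<open>The first coordinate is forced by comparing the coefficients of \<open>a\<close> in h(x,
  a y) = a h(x, y).\<close>

definition herm :: "('v \<Rightarrow> 'v \<Rightarrow> 'f) \<Rightarrow> 'v \<Rightarrow> 'v \<Rightarrow> 'v \<Rightarrow> 'v" where
  "herm q = (\<lambda>x y. elem (q x (a y) - t * q x y) (q x y))"

lemma skew_coeff_simps:
  assumes "skew_coeff q"
  shows "q (a x) y = t * q x y - q x (a y)" "2 * q x (a x) = t * q x x"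
proof -
  show 1: "q (a x) y = t * q x y - q x (a y)" for x y
    using assms by (auto simp: skew_coeff_def algebra_simps)
  have "q (a x) x = q x (a x)"
    using assms by (simp add: skew_coeff_def)
  then show "2 * q x (a x) = t * q x x"
    using 1[of x x] by simp
qed

lemma skew_hermitian_herm:
  assumes q: "skew_coeff q"
  shows "skew_hermitian scale L (herm q)"
proof -
  have bil: "bilinear_form scale q" and sym: "\<And>x y. q y x = q x y"
    using q by (auto simp: skew_coeff_def)
  note simps = bilinear_form_simps[OF bil]
  have "herm q x (b y) = b \<circ> herm q x y" if b: "b \<in> L" for b x y
  proof -
    obtain \<alpha> \<beta> where "b = elem \<alpha> \<beta>"
      by (rule L_cases[OF b])
    then show ?thesis
      by (simp add: herm_def elem_comp elem_eq_iff)
        (simp add: elem_def generator_simps square simps algebra_simps)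
  qed
  moreover have "herm q y x = - conjugation scale L (herm q x y)" for x y
  proof -
    have "q y (a x) = t * q x y - q x (a y)"
      using sym[of "a x" y] skew_coeff_simps(1)[OF q, of x y] by simp
    then show ?thesis
      by (simp add: herm_def conjugation_elem elem_uminus elem_eq_iff sym[of x y])
  qed
  moreover have "herm q x (y + z) = herm q x y + herm q x z" for x y z
    by (simp add: herm_def elem_add generator_simps simps algebra_simps)
  moreover have "herm q x y \<in> L" for x y
    by (simp add: herm_def elem_in_L)
  ultimately show ?thesis
    unfolding skew_hermitian_def by blast
qed

text \<open>Both coordinates of h(y, x) = - \<sigma>(h(x, y)) are used: the one along
  \<open>a\<close> gives the symmetry of \<open>q\<close>, the constant one the adjoint
  relation.\<close>

lemma skew_hermitian_iff: "skew_hermitian scale L h \<longleftrightarrow> (\<exists>q. skew_coeff q \<and> h = herm q)"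
proof
  assume h: "skew_hermitian scale L h"
  then have "\<exists>\<alpha> \<beta>. h x y = elem \<alpha> \<beta>" for x y
    by (metis L_cases skew_hermitian_def)
  then obtain p q where pq: "\<And>x y. h x y = elem (p x y) (q x y)"
    by metis
  have h_add: "h x (y + z) = h x y + h x z"
    and lin: "b \<in> L \<Longrightarrow> h x (b y) = b \<circ> h x y"
    and skew: "h y x = - conjugation scale L (h x y)" for x y z b
    using h unfolding skew_hermitian_def by blast+
  have add: "q x (y + z) = q x y + q x z" for x y z
    using h_add[of x y z] by (simp add: pq elem_add elem_eq_iff)
  have scale: "q x (c *s y) = c * q x y" for x y c
    using lin[OF elem_in_L[of c 0], of x y] unfolding pq elem_comp elem_eq_iff by (simp add: elem_def)
  have gen: "p x y = q x (a y) - t * q x y" for x y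
    using lin[OF elem_in_L[of 0 1], of x y] unfolding pq elem_comp elem_eq_iff by (simp add: elem_def)
  have sym: "q y x = q x y" "p y x = - p x y - t * q x y" for x y
    using skew[of y x] by (simp_all add: pq conjugation_elem elem_uminus elem_eq_iff)
  have "q (a x) y + q x (a y) = t * q x y" for x y
    using gen[of x y] gen[of y x] sym(1)[of x y] sym(2)[of x y] sym(1)[of y "a x"] by (simp add: algebra_simps)
  moreover have "q (x + y) z = q x z + q y z" "q (c *s x) y = c * q x y" for x y z c
    using add[of z x y] scale[of y c x] sym(1)[of z "x + y"] sym(1)[of z x] sym(1)[of z y]
      sym(1)[of y "c *s x"] sym(1)[of y x]
    by (simp_all only:)
  ultimately have "skew_coeff q"
    using add scale sym(1) unfolding skew_coeff_def bilinear_form_iff by blast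
  moreover have "h = herm q"
    by (simp add: fun_eq_iff pq herm_def gen)
  ultimately show "\<exists>q. skew_coeff q \<and> h = herm q" by blast
qed (auto intro: skew_hermitian_herm)

text \<open>Skewness makes h(x, x) traceless, so only the component of \<lambda> along
  \<open>a\<close> contributes; the right-hand side is the trace of a h(x, x).\<close>

lemma trace_compatible_herm_iff:
  assumes q: "skew_coeff q" and s: "s \<in> alt_forms scale"
  shows "trace_compatible scale L (herm q) s \<longleftrightarrow>
    (\<forall>x. s x (a x) = t * q x (a x) - 2 * m * q x x)"
proof -
  have tr: "ext_trace scale L (herm q x (elem \<alpha> \<beta> x)) = \<beta> * (t * q x (a x) - 2 * m * q x x)" for x \<alpha> \<beta>
  proof -
    have "herm q x (elem \<alpha> \<beta> x) = elem \<alpha> \<beta> \<circ> herm q x x"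
      using skew_hermitian_herm[OF q] elem_in_L unfolding skew_hermitian_def by blast
    then have "ext_trace scale L (herm q x (elem \<alpha> \<beta> x)) =
      \<beta> * (t * q x (a x) - 2 * m * q x x) + \<alpha> * (2 * q x (a x) - t * q x x)"
      by (simp add: herm_def elem_comp ext_trace_elem algebra_simps)
    then show ?thesis
      by (simp add: skew_coeff_simps(2)[OF q])
  qed
  have "s x (elem \<alpha> \<beta> x) = \<beta> * s x (a x)" for x \<alpha> \<beta>
    using s by (simp add: alt_forms_def elem_def bilinear_form_simps)
  moreover have "trace_compatible scale L (herm q) s \<longleftrightarrow>
    (\<forall>x \<alpha> \<beta>. s x (elem \<alpha> \<beta> x) = ext_trace scale L (herm q x (elem \<alpha> \<beta> x)))"
    unfolding trace_compatible_def L_eq by auto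
  ultimately show ?thesis
    unfolding tr by (metis mult_1)
qed

section \<open>The skew-Hermitian form attached to an alternating form\<close>

definition polar :: "('v \<Rightarrow> 'v \<Rightarrow> 'f) \<Rightarrow> 'v \<Rightarrow> 'v \<Rightarrow> 'f" where
  "polar s = (\<lambda>x y. s x (a y) - s (a x) y)"

definition alt_coeff :: "('v \<Rightarrow> 'v \<Rightarrow> 'f) \<Rightarrow> 'v \<Rightarrow> 'v \<Rightarrow> 'f" where
  "alt_coeff s = (\<lambda>x y. polar s x y / (t * t - 4 * m))"

lemma skew_coeff_alt_coeff:
  assumes "s \<in> alt_forms scale"
  shows "skew_coeff (alt_coeff s)"
proof -
  have bil: "bilinear_form scale s"
    using assms by (simp add: alt_forms_def)
  note simps = bilinear_form_simps[OF bil] generator_simps square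
  have "bilinear_form scale (alt_coeff s)"
    unfolding bilinear_form_iff
    by (auto simp: alt_coeff_def polar_def simps algebra_simps add_divide_distrib diff_divide_distrib)
  moreover have "polar s y x = polar s x y" for x y
    using alt_form_skew[OF assms, of y "a x"] alt_form_skew[OF assms, of "a y" x]
    by (simp add: polar_def)
  moreover have "polar s (a x) y + polar s x (a y) = t * polar s x y" for x y
    by (simp add: polar_def simps algebra_simps)
  ultimately show ?thesis
    by (simp add: skew_coeff_def alt_coeff_def add_divide_distrib[symmetric])
qed

text \<open>Since \<open>s\<close> is alternating, \<open>polar s x x\<close> is twice
  \<open>s x (a x)\<close> and \<open>polar s x (a x)\<close> is \<open>t\<close> times it. Hence
  \<open>polar s\<close> determines the diagonal, even in characteristic 2.\<close>

lemma discriminant_mult_alt_form: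
  assumes "s \<in> alt_forms scale"
  shows "(t * t - 4 * m) * s x (a x) = t * polar s x (a x) - 2 * m * polar s x x"
proof -
  have "bilinear_form scale s" "\<And>x. s x x = 0"
    using assms by (auto simp: alt_forms_def)
  then show ?thesis
    using alt_form_skew[OF assms, of "a x" x]
    by (simp add: polar_def bilinear_form_simps generator_simps square algebra_simps)
qed

lemma trace_compatible_alt_coeff:
  assumes "s \<in> alt_forms scale"
  shows "trace_compatible scale L (herm (alt_coeff s)) s"
proof -
  have "s x (a x) = t * alt_coeff s x (a x) - 2 * m * alt_coeff s x x" for x
  proof -
    have "t * alt_coeff s x (a x) - 2 * m * alt_coeff s x x =
      (t * polar s x (a x) - 2 * m * polar s x x) / (t * t - 4 * m)"
      by (simp add: alt_coeff_def diff_divide_distrib)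
    then show ?thesis
      unfolding discriminant_mult_alt_form[OF assms, of x, symmetric] using discriminant by simp
  qed
  then show ?thesis
    by (simp add: trace_compatible_herm_iff[OF skew_coeff_alt_coeff[OF assms] assms])
qed

text \<open>The diagonal of a symmetric form does not determine it in characteristic 2; it is the
  invertibility of the discriminant that recovers \<open>q\<close>, after polarizing \<open>x \<mapsto> s(x, ax)\<close>.\<close>

lemma trace_compatible_unique:
  assumes q: "skew_coeff q" and s: "s \<in> alt_forms scale"
    and tc: "trace_compatible scale L (herm q) s"
  shows "q = alt_coeff s"
proof (intro ext)
  fix x y
  have diag: "\<And>x. s x (a x) = t * q x (a x) - 2 * m * q x x"
    using tc trace_compatible_herm_iff[OF q s] by blast
  have bil: "bilinear_form scale q" "bilinear_form scale s" and sym: "q y x = q x y"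
    using q s by (auto simp: skew_coeff_def alt_forms_def)
  note simps = bilinear_form_simps[OF bil(1)] bilinear_form_simps[OF bil(2)] generator_simps
  have "s x (a y) + s y (a x) = t * (q x (a y) + q y (a x)) - 4 * m * q x y"
    using diag[of "x + y"] unfolding simps diag[of x] diag[of y] sym by (simp add: algebra_simps)
  moreover have "q x (a y) + q y (a x) = t * q x y"
  proof -
    have "q y (a x) = q (a x) y"
      using q by (simp add: skew_coeff_def)
    then show ?thesis
      by (simp add: skew_coeff_simps(1)[OF q])
  qed
  moreover have "s x (a y) + s y (a x) = polar s x y"
    using alt_form_skew[OF s, of "a x" y] by (simp add: polar_def)
  ultimately have "polar s x y = (t * t - 4 * m) * q x y"
    by (simp add: algebra_simps)
  then show "q x y = alt_coeff s x y"
    using discriminant by (simp add: alt_coeff_def)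
qed

section \<open>Affine spaces of alternating forms directed by \<open>W\<^sub>L\<close>\<close>

lemma subspace_W_space: "module.subspace form_scale (W_space scale L)"
proof -
  interpret F: vector_space "form_scale :: 'f \<Rightarrow> ('v \<Rightarrow> 'v \<Rightarrow> 'f) \<Rightarrow> _"
    by (rule vector_space_form_scale)
  show ?thesis
    by (auto simp: F.subspace_def W_space_iff alt_forms_def bilinear_form_iff form_scale_def
        algebra_simps)
qed

text \<open>Two alternating forms differ by an element of \<open>W\<^sub>L\<close> exactly when they
  agree at all pairs (x, a x).\<close>

lemma affine_W_space_iff:
  "affine_alt_subspace scale S (W_space scale L) \<longleftrightarrow>
    (\<exists>s0\<in>alt_forms scale. S = {s \<in> alt_forms scale. \<forall>x. s x (a x) = s0 x (a x)})"
proof -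
  have "(\<lambda>w. s0 + w) ` W_space scale L = {s \<in> alt_forms scale. \<forall>x. s x (a x) = s0 x (a x)}"
    if "s0 \<in> alt_forms scale" for s0
  proof (intro equalityI subsetI)
    fix s assume "s \<in> (\<lambda>w. s0 + w) ` W_space scale L"
    then show "s \<in> {s \<in> alt_forms scale. \<forall>x. s x (a x) = s0 x (a x)}"
      using that by (auto simp: W_space_iff alt_forms_def bilinear_form_iff algebra_simps)
  next
    fix s assume "s \<in> {s \<in> alt_forms scale. \<forall>x. s x (a x) = s0 x (a x)}"
    then have "s - s0 \<in> W_space scale L"
      using that by (auto simp: W_space_iff alt_forms_def bilinear_form_iff algebra_simps)
    then show "s \<in> (\<lambda>w. s0 + w) ` W_space scale L"
      by (intro image_eqI[of _ _ "s - s0"]) simp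
  qed
  moreover have "W_space scale L \<subseteq> alt_forms scale"
    by (auto simp: W_space_iff)
  ultimately show ?thesis
    using subspace_W_space by (auto simp: affine_alt_subspace_def)
qed

lemma affine_W_spaceE:
  assumes "affine_alt_subspace scale S (W_space scale L)" "s \<in> S"
  shows "s \<in> alt_forms scale" "S = {s' \<in> alt_forms scale. \<forall>x. s' x (a x) = s x (a x)}"
  using assms by (auto simp: affine_W_space_iff)

lemma affine_nonempty: "affine_alt_subspace scale S (W_space scale L) \<Longrightarrow> \<exists>s. s \<in> S"
  by (auto simp: affine_W_space_iff)

text \<open>Compatibility depends only on the values at (x, a x), which all members of
  \<open>S\<close> share, so a single \<open>s\<close> decides. The equation for \<open>h\<close>
  gives existence and uniqueness at once.\<close>

lemma affine_trace_compatible_iff: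
  assumes "affine_alt_subspace scale S (W_space scale L)" "s \<in> S"
  shows "skew_hermitian scale L h \<and> (\<forall>s\<in>S. trace_compatible scale L h s) \<longleftrightarrow>
    h = herm (alt_coeff s)"
proof
  note s = affine_W_spaceE[OF assms]
  assume h: "skew_hermitian scale L h \<and> (\<forall>s\<in>S. trace_compatible scale L h s)"
  then obtain q where "skew_coeff q" "h = herm q"
    by (auto simp: skew_hermitian_iff)
  then show "h = herm (alt_coeff s)"
    using trace_compatible_unique s(1) h assms(2) by blast
next
  note s = affine_W_spaceE[OF assms]
  assume h: "h = herm (alt_coeff s)"
  have "trace_compatible scale L h s'" if "s' \<in> S" for s'
    using that trace_compatible_alt_coeff[OF s(1)] s
    by (simp add: h trace_compatible_herm_iff[OF skew_coeff_alt_coeff])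
  then show "skew_hermitian scale L h \<and> (\<forall>s\<in>S. trace_compatible scale L h s)"
    using h skew_hermitian_herm skew_coeff_alt_coeff s(1) by blast
qed

lemma assoc_form_eq:
  assumes "affine_alt_subspace scale S (W_space scale L)" "s \<in> S"
  shows "assoc_form scale L S = herm (alt_coeff s)"
  unfolding assoc_form_def affine_trace_compatible_iff[OF assms] by simp

section \<open>Explicit elements of \<open>W\<^sub>L\<close> and the recovery of \<open>L\<close>
  from \<open>W\<^sub>L\<close>\<close>

text \<open>Let F and G be the \<open>L\<close>-linear functionals whose coefficients along
  \<open>a\<close> are \<open>f\<close> and \<open>g\<close>. The form is the coefficient along
  \<open>a\<close> of F(u) G(v) - F(v) G(u), which vanishes when v is an \<open>L\<close>-multiple
  of u.\<close>

lemma W_space_intro: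
  assumes "Vector_Spaces.linear scale (*) f" "Vector_Spaces.linear scale (*) g"
  shows "(\<lambda>u v. f (a u) * g v + f u * g (a v) - t * f u * g v
    - (f (a v) * g u + f v * g (a u) - t * f v * g u)) \<in> W_space scale L"
proof -
  have diff: "h (x - y) = h x - h y" if "\<forall>x y. h (x + y) = h x + h y" for h :: "'v \<Rightarrow> 'f" and x y
    using that by (metis add_diff_cancel_right' diff_add_cancel)
  show ?thesis
    using assms unfolding W_space_iff alt_forms_def bilinear_form_iff linear_iff_pointwise
    by (auto simp: generator_simps square diff algebra_simps)
qed

end

lemma (in vector_space) linear_functional_exists:
  assumes "independent B"
  shows "\<exists>g. Vector_Spaces.linear scale (*) g \<and> (\<forall>x\<in>B. g x = f x)"
proof -
  interpret vector_space_pair scale "(*)"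
    by (intro vector_space_pair.intro vector_space_axioms vector_space_mult)
  show ?thesis
    using linear_independent_extend[OF assms] .
qed

context separable_generator
begin

lemma elem_apply_comp:
  "elem \<alpha> \<beta> (elem \<gamma> \<epsilon> x) = elem (\<alpha> * \<gamma> - m * \<beta> * \<epsilon>) (\<alpha> * \<epsilon> + \<beta> * \<gamma> + t * \<beta> * \<epsilon>) x"
  using fun_cong[OF elem_comp, of \<alpha> \<beta> \<gamma> \<epsilon> x] by simp

text \<open>Division in \<open>L\<close>: multiply by the conjugate of \<gamma> + \<epsilon> a and
  divide by the norm.\<close>

lemma elem_solve:
  assumes "elem \<gamma> \<epsilon> y = elem \<alpha> \<beta> x" "\<gamma> \<noteq> 0 \<or> \<epsilon> \<noteq> 0"
  shows "\<exists>\<alpha> \<beta>. y = elem \<alpha> \<beta> x"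
proof -
  let ?N = "\<gamma> * \<gamma> + t * \<gamma> * \<epsilon> + m * \<epsilon> * \<epsilon>"
  have N: "?N \<noteq> 0"
    using norm_nonzero assms(2) by blast
  have "elem (\<gamma> + t * \<epsilon>) (- \<epsilon>) (elem \<gamma> \<epsilon> y) = elem ?N 0 y"
    by (simp add: elem_apply_comp algebra_simps)
  then have "elem (inverse ?N) 0 (elem ?N 0 y) = elem (inverse ?N) 0 (elem (\<gamma> + t * \<epsilon>) (- \<epsilon>) (elem \<alpha> \<beta> x))"
    using assms(1) by simp
  then have "y = elem (inverse ?N) 0 (elem (\<gamma> + t * \<epsilon>) (- \<epsilon>) (elem \<alpha> \<beta> x))"
    using N by (simp add: elem_apply_comp[of "inverse ?N" 0 ?N]) (simp add: elem_def)
  then show ?thesis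
    unfolding elem_apply_comp by blast
qed

lemma independent_pair:
  assumes "x \<noteq> 0"
  shows "independent {a x, x}" "a x \<noteq> x"
proof -
  have ne: "a x \<noteq> k *s x" for k
    using elem_inj[of "- k" 1 x] assms by (auto simp: elem_def)
  then show "independent {a x, x}"
    using assms by (auto simp: independent_insert span_breakdown_eq dependent_single)
  show "a x \<noteq> x"
    using ne[of 1] by simp
qed

lemma span_pair: "y \<in> span {a x, x} \<longleftrightarrow> (\<exists>\<alpha> \<beta>. y = elem \<alpha> \<beta> x)"
proof
  assume "y \<in> span {a x, x}"
  then obtain k l where "y - k *s a x - l *s x \<in> span {}"
    by (metis span_breakdown_eq)
  then have "y = elem l k x"
    by (simp add: elem_def algebra_simps)
  then show "\<exists>\<alpha> \<beta>. y = elem \<alpha> \<beta> x" by blast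
next
  assume "\<exists>\<alpha> \<beta>. y = elem \<alpha> \<beta> x"
  then show "y \<in> span {a x, x}"
    unfolding elem_def by (blast intro: span_add span_scale span_base)
qed

text \<open>Independence over \<open>L\<close> of \<open>x\<close> and \<open>y\<close> gives
  independence over the base field of \<open>x\<close>, \<open>a x\<close>, \<open>y\<close>,
  \<open>a y\<close>: a relation for \<open>a y\<close> would place (a - k) y, hence
  \<open>y\<close>, on the \<open>L\<close>-line of \<open>x\<close>.\<close>

lemma independent_quadruple:
  assumes "x \<noteq> 0" "\<nexists>\<alpha> \<beta>. y = elem \<alpha> \<beta> x"
  shows "independent {a y, y, a x, x}" "distinct [a y, y, a x, x]"
proof -
  have y: "y \<notin> span {a x, x}"
    using assms(2) span_pair by blast
  have ay: "a y \<notin> span {y, a x, x}"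
  proof
    assume "a y \<in> span {y, a x, x}"
    then obtain k where "a y - k *s y \<in> span {a x, x}"
      by (metis span_breakdown_eq)
    then obtain \<alpha> \<beta> where "elem (- k) 1 y = elem \<alpha> \<beta> x"
      by (auto simp: span_pair elem_def)
    then show False
      using elem_solve[of "- k" 1 y \<alpha> \<beta> x] assms(2) by auto
  qed
  show "independent {a y, y, a x, x}"
    by (intro independent_insertI y ay independent_pair assms)
  show "distinct [a y, y, a x, x]"
    using y ay independent_pair(2)[OF assms(1)] by (auto intro: span_base)
qed

lemma not_all_multiples:
  assumes "dim (UNIV :: 'v set) \<ge> 4"
  shows "\<exists>y. \<nexists>\<alpha> \<beta>. y = elem \<alpha> \<beta> x"
proof (rule ccontr)
  assume "\<not> ?thesis"
  then have "UNIV \<subseteq> span {a x, x}"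
    by (auto simp: span_pair)
  then have "dim (UNIV :: 'v set) \<le> card {a x, x}"
    by (intro dim_le_card) auto
  also have "\<dots> \<le> 2"
    by (simp add: card_insert_if)
  finally show False
    using assms by simp
qed

text \<open>First \<open>u\<close> preserves every \<open>L\<close>-line, since otherwise some
  \<open>w\<close> separates \<open>x\<close> from \<open>u x\<close>; then the factors on different
  lines are shown to coincide.\<close>

lemma W_space_recovers_L:
  assumes dim: "dim (UNIV :: 'v set) \<ge> 4"
    and u: "Vector_Spaces.linear scale scale u"
    and W: "\<And>w x. w \<in> W_space scale L \<Longrightarrow> w x (u x) = 0"
  shows "u \<in> L"
proof -
  have u_add: "u (x + y) = u x + u y" and u_scale: "u (c *s x) = c *s u x" for x y c
    using u by (auto simp: linear_endo_iff)
  have line: "\<exists>\<alpha> \<beta>. u x = elem \<alpha> \<beta> x" for x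
  proof (cases "x = 0")
    case True
    then show ?thesis
      using u_scale[of 0 x] by (auto simp: elem_def generator_simps)
  next
    case False
    show ?thesis
    proof (rule ccontr)
      assume nex: "\<not> ?thesis"
      let ?y = "u x"
      note ind = independent_quadruple[OF False nex]
      obtain f where f: "Vector_Spaces.linear scale (*) f"
        "\<forall>z\<in>{a ?y, ?y, a x, x}. f z = (if z = a x then 1 else 0)"
        using linear_functional_exists[OF ind(1), of "\<lambda>z. if z = a x then 1 else 0"] by blast
      obtain g where g: "Vector_Spaces.linear scale (*) g"
        "\<forall>z\<in>{a ?y, ?y, a x, x}. g z = (if z = ?y then 1 else 0)"
        using linear_functional_exists[OF ind(1), of "\<lambda>z. if z = ?y then 1 else 0"] by blast
      \<comment> \<open>With these values the form built from \<open>f\<close> and \<open>g\<close>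
        takes the value 1 at \<open>x\<close> and \<open>u x\<close>.\<close>
      have "f (a x) = 1" "f x = 0" "f ?y = 0" "f (a ?y) = 0"
        "g (a x) = 0" "g x = 0" "g ?y = 1" "g (a ?y) = 0"
        using f(2) g(2) ind(2) by auto
      then show False
        using W[OF W_space_intro[OF f(1) g(1)], of x] by simp
    qed
  qed
  obtain x :: 'v where "x \<noteq> 0"
    using exists_nonzero by blast
  obtain \<alpha> \<beta> where x: "u x = elem \<alpha> \<beta> x"
    using line by blast
  \<comment> \<open>The usual comparison of \<open>u (x + y)\<close> with \<open>u x + u y\<close>,
    for \<open>y\<close> independent of \<open>x\<close> over \<open>L\<close>.\<close>
  have out: "u y = elem \<alpha> \<beta> y" if y: "\<nexists>\<alpha> \<beta>. y = elem \<alpha> \<beta> x" for y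
  proof -
    obtain \<gamma> \<epsilon> where g: "u y = elem \<gamma> \<epsilon> y"
      using line by blast
    obtain \<zeta> \<eta> where z: "u (x + y) = elem \<zeta> \<eta> (x + y)"
      using line by blast
    have eq: "elem (\<zeta> - \<gamma>) (\<eta> - \<epsilon>) y = elem (\<alpha> - \<zeta>) (\<beta> - \<eta>) x"
      using z unfolding u_add x g by (simp add: elem_def generator_simps algebra_simps)
    then have ge: "\<zeta> = \<gamma>" "\<eta> = \<epsilon>"
      using elem_solve[OF eq] y by auto
    then have "elem (\<alpha> - \<zeta>) (\<beta> - \<eta>) x = 0"
      using eq by (simp add: elem_def)
    then have "\<alpha> = \<zeta>" "\<beta> = \<eta>"
      using elem_inj \<open>x \<noteq> 0\<close> by force+
    then show ?thesis
      using g ge by simp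
  qed
  \<comment> \<open>As \<open>u\<close> is not yet known to be \<open>L\<close>-linear, points on
    the line of \<open>x\<close> need a detour: both \<open>z\<close> and \<open>y + z\<close> lie
    off that line.\<close>
  have "u y = elem \<alpha> \<beta> y" for y
  proof (cases "\<exists>\<alpha> \<beta>. y = elem \<alpha> \<beta> x")
    case True
    then obtain \<gamma> \<epsilon> where y: "y = elem \<gamma> \<epsilon> x" by blast
    obtain z where z: "\<nexists>\<alpha> \<beta>. z = elem \<alpha> \<beta> x"
      using not_all_multiples[OF dim] by blast
    have "\<nexists>\<alpha> \<beta>. y + z = elem \<alpha> \<beta> x"
    proof
      assume "\<exists>\<alpha> \<beta>. y + z = elem \<alpha> \<beta> x"
      then obtain \<zeta> \<eta> where "y + z = elem \<zeta> \<eta> x" by blast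
      then have "z = elem (\<zeta> - \<gamma>) (\<eta> - \<epsilon>) x"
        by (simp add: y elem_def algebra_simps)
      then show False using z by blast
    qed
    then show ?thesis
      using out[of "y + z"] out[OF z] by (simp add: u_add elem_def generator_simps algebra_simps)
  qed (rule out)
  then have "u = elem \<alpha> \<beta>" by blast
  then show ?thesis
    by (simp add: elem_in_L)
qed

section \<open>Forms compatible with a given skew-Hermitian form; nonisotropy\<close>

lemma compatible_forms_affine:
  assumes q: "skew_coeff q"
  shows "affine_alt_subspace scale {s \<in> alt_forms scale. trace_compatible scale L (herm q) s}
    (W_space scale L)"
proof -
  have bil: "bilinear_form scale q" and sym: "\<And>x y. q y x = q x y"
    using q by (auto simp: skew_coeff_def)
  note simps = bilinear_form_simps[OF bil] generator_simps square
  \<comment> \<open>This is the trace of \<open>herm q x y\<close>, a natural base point.\<close>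
  let ?s = "\<lambda>x y. 2 * q x (a y) - t * q x y"
  have "?s \<in> alt_forms scale"
    by (auto simp: alt_forms_def bilinear_form_iff simps skew_coeff_simps(2)[OF q] algebra_simps)
  moreover have "?s x (a x) = t * q x (a x) - 2 * m * q x x" for x
    using skew_coeff_simps(2)[OF q, of x] by (simp add: simps algebra_simps)
  ultimately show ?thesis
    unfolding affine_W_space_iff using trace_compatible_herm_iff[OF q]
    by (intro bexI[of _ ?s]) auto
qed

text \<open>Take \<open>g = - s x\<close> and a functional \<open>f\<close> dual to
  \<open>a x\<close>. The correction terms contain \<open>g x\<close> and \<open>g (a x)\<close>,
  which are zero by assumption on \<open>s\<close>.\<close>

lemma W_space_prescribed_row:
  assumes s: "s \<in> alt_forms scale" and x: "x \<noteq> 0" "s x (a x) = 0"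
  shows "\<exists>w\<in>W_space scale L. \<forall>v. w x v = - s x v"
proof -
  have "\<exists>f. Vector_Spaces.linear scale (*) f \<and> (\<forall>z\<in>{a x, x}. f z = (if z = a x then 1 else 0))"
    by (rule linear_functional_exists[OF independent_pair(1)[OF x(1)]])
  then obtain f where f: "Vector_Spaces.linear scale (*) f" "f (a x) = 1" "f x = 0"
    using independent_pair(2)[OF x(1)] by auto
  have bil: "bilinear_form scale s" and "s x x = 0"
    using s by (auto simp: alt_forms_def)
  have "Vector_Spaces.linear scale (*) (\<lambda>v. - s x v)"
    by (simp add: linear_iff_pointwise bilinear_form_simps[OF bil])
  from W_space_intro[OF f(1) this] show ?thesis
    by (rule bexI[rotated]) (simp add: f x(2) \<open>s x x = 0\<close>)
qed

lemma symplectic_iff_nonisotropic: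
  assumes q: "skew_coeff q"
  shows "symplectic {s \<in> alt_forms scale. trace_compatible scale L (herm q) s} \<longleftrightarrow>
    nonisotropic (herm q)"
proof
  let ?S = "{s \<in> alt_forms scale. trace_compatible scale L (herm q) s}"
  note aff = compatible_forms_affine[OF q]
  assume symp: "symplectic ?S"
  show "nonisotropic (herm q)"
    unfolding nonisotropic_def
  proof (intro allI impI notI)
    fix x :: 'v assume x: "x \<noteq> 0" "herm q x x = 0"
    obtain s where s: "s \<in> ?S"
      using affine_nonempty[OF aff] by blast
    have "q x x = 0" "q x (a x) = 0"
      using x(2) by (auto simp: herm_def elem_eq_0_iff)
    then have "s x (a x) = 0"
      using s trace_compatible_herm_iff[OF q, of s] by simp
    then obtain w where w: "w \<in> W_space scale L" "\<And>v. w x v = - s x v"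
      using W_space_prescribed_row[of s x] s x(1) by blast
    have "s + w \<in> {s' \<in> alt_forms scale. \<forall>x. s' x (a x) = s x (a x)}"
      using s w(1) by (auto simp: W_space_iff alt_forms_def bilinear_form_iff algebra_simps)
    then have "s + w \<in> ?S"
      using affine_W_spaceE(2)[OF aff s] by simp
    then have "nondegenerate (s + w)"
      using symp by (simp add: symplectic_def)
    then show False
      using x(1) w(2) by (auto simp: nondegenerate_def)
  qed
next
  assume noniso: "nonisotropic (herm q)"
  show "symplectic {s \<in> alt_forms scale. trace_compatible scale L (herm q) s}"
    unfolding symplectic_def nondegenerate_def
  proof (intro ballI allI impI)
    fix s x
    assume s: "s \<in> {s \<in> alt_forms scale. trace_compatible scale L (herm q) s}" "\<forall>y. s x y = 0"
    then have 1: "t * q x (a x) - 2 * m * q x x = 0"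
      using trace_compatible_herm_iff[OF q, of s] by (metis mem_Collect_eq)
    note 2 = skew_coeff_simps(2)[OF q, of x]
    \<comment> \<open>Nonisotropy is contradicted one coefficient at a time: first
      \<open>q x x\<close>, then \<open>q x (a x)\<close>, which is killed by both 2 and
      \<open>t\<close>.\<close>
    have "(t * t - 4 * m) * q x x = 0"
      using 1 2 by algebra
    then have "q x x = 0"
      using discriminant by simp
    then have "q x (a x) = 0"
      using 1 2 eq_zero_of_two_mult[OF _ _ discriminant, of "q x (a x)"] by simp
    then have "herm q x x = 0"
      using \<open>q x x = 0\<close> by (simp add: herm_def elem_eq_0_iff)
    then show "x = 0"
      using noniso by (auto simp: nonisotropic_def)
  qed
qed

section \<open>Real forms, orthogonal bases and semilinear isometries\<close>

text \<open>A real form of \<open>q\<close> spans, over \<open>L\<close>, a subspace with an \<open>L\<close>-basis that is orthogonal for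
  \<open>herm q\<close>; the last condition says that this subspace and its orthogonal span the whole space.\<close>

definition real_form :: "('v \<Rightarrow> 'v \<Rightarrow> 'f) \<Rightarrow> 'v set \<Rightarrow> bool" where
  "real_form q R \<longleftrightarrow> subspace R \<and>
    (\<forall>r\<in>R. \<forall>r'\<in>R. r + a r' = 0 \<longrightarrow> r = 0 \<and> r' = 0) \<and>
    (\<forall>r\<in>R. \<forall>r'\<in>R. q (a r) r' = q r (a r')) \<and>
    (\<forall>v. \<exists>r\<in>R. \<exists>r'\<in>R. \<exists>w. (\<forall>u\<in>R. q u w = 0 \<and> q u (a w) = 0) \<and> v = r + a r' + w)"

text \<open>Orthogonal projection along \<open>x\<close>: the coefficient is h(x, w) / h(x, x) with
  \<open>h = herm q\<close>, and the hypothesis says h(x, x) is nonzero.\<close>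

lemma anisotropic_projection:
  assumes q: "skew_coeff q" and x: "q x x \<noteq> 0 \<or> q x (a x) \<noteq> 0"
  shows "\<exists>\<alpha> \<beta>. q x (w - elem \<alpha> \<beta> x) = 0 \<and> q x (a (w - elem \<alpha> \<beta> x)) = 0"
proof -
  have bil: "bilinear_form scale q" and sym: "\<And>x y. q y x = q x y"
    using q by (auto simp: skew_coeff_def)
  \<comment> \<open>The norm of h(x, x). Below, \<alpha> + \<beta> a is h(x, w) times the conjugate
    of h(x, x), divided by \<open>N\<close>.\<close>
  define N where "N = q x (a x) * q x (a x) + t * q x (a x) * - q x x + m * - q x x * - q x x"
  have N: "N \<noteq> 0"
  proof
    assume "N = 0"
    then have "q x (a x) = 0 \<and> - q x x = 0"
      unfolding N_def by (rule norm_nonzero)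
    then show False
      using x by simp
  qed
  define \<alpha> where "\<alpha> = (q x (a x) * q x (a w) - (t * q x (a x) - m * q x x) * q x w) / N"
  define \<beta> where "\<beta> = (q x (a x) * q x w - q x x * q x (a w)) / N"
  have ab: "\<alpha> * N = q x (a x) * q x (a w) - (t * q x (a x) - m * q x x) * q x w"
    "\<beta> * N = q x (a x) * q x w - q x x * q x (a w)"
    using N by (simp_all add: \<alpha>_def \<beta>_def)
  have "N * (q x w - \<alpha> * q x x - \<beta> * q x (a x)) = N * q x w - \<alpha> * N * q x x - \<beta> * N * q x (a x)"
    by (simp add: algebra_simps)
  also have "\<dots> = 0"
    unfolding ab unfolding N_def by (simp add: algebra_simps)
  finally have 1: "N * (q x w - \<alpha> * q x x - \<beta> * q x (a x)) = 0" .
  have "N * (q x (a w) - \<alpha> * q x (a x) - \<beta> * (t * q x (a x) - m * q x x)) =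
    N * q x (a w) - \<alpha> * N * q x (a x) - \<beta> * N * (t * q x (a x) - m * q x x)"
    by (simp add: algebra_simps)
  also have "\<dots> = 0"
    unfolding ab unfolding N_def by (simp add: algebra_simps)
  finally have 2: "N * (q x (a w) - \<alpha> * q x (a x) - \<beta> * (t * q x (a x) - m * q x x)) = 0" .
  from 1 2 have "q x w - \<alpha> * q x x - \<beta> * q x (a x) = 0"
    "q x (a w) - \<alpha> * q x (a x) - \<beta> * (t * q x (a x) - m * q x x) = 0"
    using N by (simp_all only: mult_eq_0_iff simp_thms)
  then have "q x (w - elem \<alpha> \<beta> x) = 0 \<and> q x (a (w - elem \<alpha> \<beta> x)) = 0"
    by (simp add: elem_def bilinear_form_simps[OF bil] generator_simps square algebra_simps)
  then show ?thesis by blast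
qed

text \<open>The projection hypothesis is abstract so as to cover both an anisotropic
  \<open>x\<close> and an \<open>x\<close> orthogonal to the whole complement of
  \<open>R\<close>.\<close>

lemma real_form_insert:
  assumes q: "skew_coeff q" and R: "real_form q R"
    and x: "\<And>r r'. r \<in> R \<Longrightarrow> r' \<in> R \<Longrightarrow> x \<noteq> r + a r'" "\<And>u. u \<in> R \<Longrightarrow> q u x = 0 \<and> q u (a x) = 0"
    and proj: "\<And>w. (\<And>u. u \<in> R \<Longrightarrow> q u w = 0 \<and> q u (a w) = 0) \<Longrightarrow>
      \<exists>\<alpha> \<beta>. q x (w - elem \<alpha> \<beta> x) = 0 \<and> q x (a (w - elem \<alpha> \<beta> x)) = 0"
  shows "real_form q (span (insert x R))"
proof -
  have sub: "subspace R"
    and free: "\<And>r r'. r \<in> R \<Longrightarrow> r' \<in> R \<Longrightarrow> r + a r' = 0 \<Longrightarrow> r = 0 \<and> r' = 0"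
    and comm: "\<And>r r'. r \<in> R \<Longrightarrow> r' \<in> R \<Longrightarrow> q (a r) r' = q r (a r')"
    and dec: "\<And>v. \<exists>r\<in>R. \<exists>r'\<in>R. \<exists>w. (\<forall>u\<in>R. q u w = 0 \<and> q u (a w) = 0) \<and> v = r + a r' + w"
    using R unfolding real_form_def by blast+
  have bil: "bilinear_form scale q" and sym: "\<And>x y. q y x = q x y"
    using q by (auto simp: skew_coeff_def)
  note simps = bilinear_form_simps[OF bil] generator_simps square
  note sub_simps = subspace_add[OF sub] subspace_scale[OF sub] subspace_diff[OF sub] subspace_neg[OF sub]
    subspace_0[OF sub]
  have mem: "z \<in> span (insert x R) \<longleftrightarrow> (\<exists>r\<in>R. \<exists>k. z = r + k *s x)" for z
  proof -
    have "span R = R"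
      using sub by (simp only: span_eq_iff)
    then have "z \<in> span (insert x R) \<longleftrightarrow> (\<exists>k. z - k *s x \<in> R)"
      by (simp only: span_breakdown_eq)
    also have "\<dots> \<longleftrightarrow> (\<exists>r\<in>R. \<exists>k. z = r + k *s x)"
      by (metis add_diff_cancel_right' diff_add_cancel)
    finally show ?thesis .
  qed
  \<comment> \<open>The \<open>L\<close>-line of \<open>x\<close> meets R + a R only in 0:
    otherwise, dividing in \<open>L\<close> would put \<open>x\<close> itself into R + a R.\<close>
  have line: "\<alpha> = 0 \<and> \<beta> = 0" if "r \<in> R" "r' \<in> R" "elem \<alpha> \<beta> x = r + a r'" for \<alpha> \<beta> r r'
  proof (rule ccontr)
    assume ne: "\<not> ?thesis"
    let ?N = "\<alpha> * \<alpha> + t * \<alpha> * \<beta> + m * \<beta> * \<beta>"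
    have N: "?N \<noteq> 0"
      using norm_nonzero ne by blast
    have "?N *s x = elem (\<alpha> + t * \<beta>) (- \<beta>) (elem \<alpha> \<beta> x)"
      unfolding elem_apply_comp by (simp add: elem_def algebra_simps)
    also have "\<dots> = ((\<alpha> + t * \<beta>) *s r + (m * \<beta>) *s r') + a (\<alpha> *s r' - \<beta> *s r)"
      unfolding that(3) by (simp add: elem_def generator_simps square algebra_simps)
    finally have eq: "?N *s x = \<dots>" .
    have "x = inverse ?N *s (?N *s x)"
      using N by simp
    also have "\<dots> = inverse ?N *s ((\<alpha> + t * \<beta>) *s r + (m * \<beta>) *s r')
        + a (inverse ?N *s (\<alpha> *s r' - \<beta> *s r))"
      unfolding eq generator_simps(2) by (rule scale_right_distrib)
    finally show False
      using x(1) that(1,2) sub_simps by metis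
  qed
  have "r = 0 \<and> r' = 0" if "r \<in> span (insert x R)" "r' \<in> span (insert x R)" "r + a r' = 0" for r r'
  proof -
    obtain r1 k r2 l where r: "r1 \<in> R" "r = r1 + k *s x" "r2 \<in> R" "r' = r2 + l *s x"
      using \<open>r \<in> _\<close> \<open>r' \<in> _\<close> unfolding mem by blast
    have "elem k l x + (r1 + a r2) = 0"
      using that(3) by (simp add: r elem_def generator_simps algebra_simps)
    then have "elem k l x = - r1 + a (- r2)"
      by (simp add: generator_simps eq_neg_iff_add_eq_0 algebra_simps)
    then have "k = 0 \<and> l = 0"
      by (rule line[rotated 2]) (use r sub_simps in auto)
    then show ?thesis
      using free[of r1 r2] that(3) r by simp
  qed
  moreover have "q (a r) r' = q r (a r')"
    if rr: "r \<in> span (insert x R)" "r' \<in> span (insert x R)" for r r'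
  proof -
    obtain r1 k r2 l where r: "r1 \<in> R" "r = r1 + k *s x" "r2 \<in> R" "r' = r2 + l *s x"
      using rr unfolding mem by blast
    have 1: "q (a r1) x = 0" "q r1 x = 0" "q r1 (a x) = 0"
      using x(2)[OF r(1)] skew_coeff_simps(1)[OF q, of r1 x] by auto
    have 2: "q x (a r2) = 0" "q (a x) r2 = 0"
      using x(2)[OF r(3)] skew_coeff_simps(1)[OF q, of r2 x] sym[of x "a r2"] sym[of "a x" r2] by auto
    show ?thesis
      using comm[OF r(1,3)] sym[of x "a x"] by (simp add: r(2,4) simps 1 2)
  qed
  moreover have "\<exists>r\<in>span (insert x R). \<exists>r'\<in>span (insert x R). \<exists>w.
      (\<forall>u\<in>span (insert x R). q u w = 0 \<and> q u (a w) = 0) \<and> v = r + a r' + w" for v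
  proof -
    obtain r r' w where v: "r \<in> R" "r' \<in> R" "\<forall>u\<in>R. q u w = 0 \<and> q u (a w) = 0" "v = r + a r' + w"
      using dec by blast
    then obtain \<alpha> \<beta> where ab: "q x (w - elem \<alpha> \<beta> x) = 0" "q x (a (w - elem \<alpha> \<beta> x)) = 0"
      using proj by blast
    let ?w = "w - elem \<alpha> \<beta> x"
    have "q u ?w = 0 \<and> q u (a ?w) = 0" if "u \<in> R" for u
      using v(3) x(2) that by (simp add: elem_def simps)
    then have "\<forall>u\<in>span (insert x R). q u ?w = 0 \<and> q u (a ?w) = 0"
      using ab by (auto simp: mem bilinear_form_simps(3,4)[OF bil])
    moreover have "v = (r + \<alpha> *s x) + a (r' + \<beta> *s x) + ?w"
      by (simp add: v(4) elem_def generator_simps algebra_simps)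
    moreover have "r + \<alpha> *s x \<in> span (insert x R)" "r' + \<beta> *s x \<in> span (insert x R)"
      unfolding mem using v(1,2) by blast+
    ultimately show ?thesis by blast
  qed
  ultimately show ?thesis
    unfolding real_form_def using subspace_span by blast
qed

text \<open>An anisotropic vector orthogonal to \<open>R\<close> and outside \<open>U\<close> is
  adjoined if there is one. Otherwise the complement \<open>P\<close> is totally isotropic, so
  \<open>q\<close> vanishes on it and any vector of \<open>P\<close> outside \<open>U\<close> will
  do.\<close>

lemma real_form_extend:
  assumes q: "skew_coeff q" and R: "real_form q R"
    and v: "\<And>r r'. r \<in> R \<Longrightarrow> r' \<in> R \<Longrightarrow> v \<noteq> r + a r'"
  shows "\<exists>x. x \<notin> R \<and> real_form q (span (insert x R))"
proof -
  have sub: "subspace R"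
    and dec: "\<And>v. \<exists>r\<in>R. \<exists>r'\<in>R. \<exists>w. (\<forall>u\<in>R. q u w = 0 \<and> q u (a w) = 0) \<and> v = r + a r' + w"
    using R unfolding real_form_def by blast+
  have bil: "bilinear_form scale q" and sym: "\<And>x y. q y x = q x y"
    using q by (auto simp: skew_coeff_def)
  note simps = bilinear_form_simps[OF bil] generator_simps square
  define P where "P = {w. \<forall>u\<in>R. q u w = 0 \<and> q u (a w) = 0}"
  define U where "U = {r + a r' | r r'. r \<in> R \<and> r' \<in> R}"
  have notin: "x \<notin> R" if "x \<notin> U" for x
    using that subspace_0[OF sub] unfolding U_def by (force simp: generator_simps)
  have insertI: "real_form q (span (insert x R))"
    if "x \<in> P" "x \<notin> U" "\<And>w. w \<in> P \<Longrightarrow> \<exists>\<alpha> \<beta>. q x (w - elem \<alpha> \<beta> x) = 0 \<and> q x (a (w - elem \<alpha> \<beta> x)) = 0"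
    for x
    by (rule real_form_insert[OF q R]) (use that in \<open>auto simp: P_def U_def\<close>)
  show ?thesis
  proof (cases "\<exists>x. x \<in> P \<and> x \<notin> U \<and> (q x x \<noteq> 0 \<or> q x (a x) \<noteq> 0)")
    case True
    then show ?thesis
      using insertI notin anisotropic_projection[OF q] by blast
  next
    case False
    \<comment> \<open>A vector of \<open>P\<close> lying in \<open>U\<close> is orthogonal to R + a
      R, hence to itself.\<close>
    have iso: "q x x = 0 \<and> q x (a x) = 0" if "x \<in> P" for x
    proof (cases "x \<in> U")
      case True
      then obtain r r' where r: "r \<in> R" "r' \<in> R" "x = r + a r'"
        unfolding U_def by blast
      have "q r x = 0" "q r (a x) = 0" "q r' x = 0" "q r' (a x) = 0"
        using that r unfolding P_def by blast+
      moreover have "q (a r') x = t * q r' x - q r' (a x)"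
        "q (a r') (a x) = t * q r' (a x) - q r' (t *s a x - m *s x)"
        using skew_coeff_simps(1)[OF q, of r'] square by simp_all
      moreover have "q x x = q r x + q (a r') x" "q x (a x) = q r (a x) + q (a r') (a x)"
        using bilinear_form_simps(3)[OF bil, of r "a r'"] r(3) by metis+
      ultimately show ?thesis
        by (simp add: bilinear_form_simps[OF bil])
    qed (use False that in blast)
    have P_add: "x + y \<in> P" if "x \<in> P" "y \<in> P" for x y
      using that by (simp add: P_def simps)
    \<comment> \<open>Polarizing \<open>q x x\<close> gives the factor 2, and polarizing
      \<open>q x (a x)\<close> gives the factor \<open>t\<close>; they are not both zero.\<close>
    have orth: "q x y = 0" if "x \<in> P" "y \<in> P" for x y
    proof -
      have "2 * q x y = 0"
        using iso[OF that(1)] iso[OF that(2)] iso[OF P_add[OF that]] sym[of y x] by (simp add: simps)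
      moreover have "q y (a x) = q (a x) y"
        using sym by blast
      then have "q x (a y) + (t * q x y - q x (a y)) = 0"
        using iso[OF that(1)] iso[OF that(2)] iso[OF P_add[OF that]] skew_coeff_simps(1)[OF q, of x y]
        by (simp add: simps)
      then have "t * q x y = 0" by simp
      ultimately show ?thesis
        using eq_zero_of_two_mult discriminant by blast
    qed
    have P_a: "a x \<in> P" if "x \<in> P" for x
      using that by (simp add: P_def simps)
    obtain r r' x where x: "r \<in> R" "r' \<in> R" "x \<in> P" "v = r + a r' + x"
      using dec[of v] unfolding P_def by blast
    have "x \<notin> U"
    proof
      assume "x \<in> U"
      then obtain s s' where s: "s \<in> R" "s' \<in> R" "x = s + a s'"
        unfolding U_def by blast
      then have "v = (r + s) + a (r' + s')"
        by (simp add: x(4) generator_simps algebra_simps)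
      then show False
        using v subspace_add[OF sub] x(1,2) s(1,2) by blast
    qed
    \<comment> \<open>All of \<open>P\<close> is already orthogonal to \<open>x\<close>, so the
      projection is 0.\<close>
    have "\<exists>\<alpha> \<beta>. q x (w - elem \<alpha> \<beta> x) = 0 \<and> q x (a (w - elem \<alpha> \<beta> x)) = 0" if "w \<in> P" for w
      using orth[OF x(3) that] orth[OF x(3) P_a[OF that]]
      by (intro exI[of _ 0]) (simp add: elem_def)
    then show ?thesis
      using insertI[OF x(3) \<open>x \<notin> U\<close>] notin[OF \<open>x \<notin> U\<close>] by blast
  qed
qed

text \<open>A real form of maximal dimension cannot be extended, so R + a R is everything.\<close>

lemma real_form_exists:
  assumes q: "skew_coeff q" and dim: "dim (UNIV :: 'v set) > 0"
  shows "\<exists>R. real_form q R \<and> (\<forall>v. \<exists>r\<in>R. \<exists>r'\<in>R. v = r + a r')"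
proof -
  obtain B where B: "independent B" "UNIV \<subseteq> span B" "card B = dim (UNIV :: 'v set)"
    using basis_exists[of UNIV] by metis
  \<comment> \<open>Infinite-dimensional spaces have \<open>dim\<close> equal to 0, so positivity
    provides a finite basis.\<close>
  then interpret finite_dimensional_vector_space scale B
    using dim by unfold_locales (auto intro: card_ge_0_finite)
  have bil: "bilinear_form scale q"
    using q by (auto simp: skew_coeff_def)
  have "real_form q {0}"
    by (simp add: real_form_def generator_simps bilinear_form_simps[OF bil])
  moreover have "\<forall>R. real_form q R \<longrightarrow> dim R < Suc (dim (UNIV :: 'v set))"
    using dim_subset[OF subset_UNIV] by (simp add: less_Suc_eq_le)
  ultimately obtain R where R: "real_form q R" "\<And>R'. real_form q R' \<Longrightarrow> dim R' \<le> dim R"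
    using ex_has_greatest_nat[of "real_form q" "{0}" dim] by metis
  show ?thesis
  proof (intro exI conjI allI)
    fix v
    show "\<exists>r\<in>R. \<exists>r'\<in>R. v = r + a r'"
    proof (rule ccontr)
      assume "\<not> ?thesis"
      then obtain x where x: "x \<notin> R" "real_form q (span (insert x R))"
        using real_form_extend[OF q R(1), of v] by blast
      have "x \<notin> span R"
        using R(1) x(1) by (metis real_form_def span_eq_iff)
      then have "dim (span (insert x R)) = Suc (dim R)"
        by (simp add: dim_insert)
      then show False
        using R(2)[OF x(2)] by simp
    qed
  qed (rule R(1))
qed

text \<open>The map fixes \<open>R\<close> and sends \<open>a\<close> to its conjugate. On a real
  form h(r, r') is symmetric, so h(\<psi> x, \<psi> y) = h(y, x), and the coefficient
  \<open>q\<close> is unchanged.\<close>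

lemma conjugation_exists:
  assumes q: "skew_coeff q" and dim: "dim (UNIV :: 'v set) > 0"
  shows "\<exists>\<psi>. Vector_Spaces.linear scale scale \<psi> \<and> bij \<psi> \<and>
    (\<forall>x. \<psi> (a x) = t *s \<psi> x - a (\<psi> x)) \<and> (\<forall>x y. q (\<psi> x) (\<psi> y) = q x y)"
proof -
  obtain R where R: "real_form q R" "\<And>v. \<exists>r\<in>R. \<exists>r'\<in>R. v = r + a r'"
    using real_form_exists[OF assms] by blast
  have sub: "subspace R"
    and free: "\<And>r r'. r \<in> R \<Longrightarrow> r' \<in> R \<Longrightarrow> r + a r' = 0 \<Longrightarrow> r = 0 \<and> r' = 0"
    and comm: "\<And>r r'. r \<in> R \<Longrightarrow> r' \<in> R \<Longrightarrow> q (a r) r' = q r (a r')"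
    using R(1) unfolding real_form_def by blast+
  have bil: "bilinear_form scale q" and sym: "\<And>x y. q y x = q x y"
    using q by (auto simp: skew_coeff_def)
  note sub_simps = subspace_add[OF sub] subspace_scale[OF sub] subspace_diff[OF sub] subspace_neg[OF sub]
  obtain f g where fg: "\<And>v. f v \<in> R" "\<And>v. g v \<in> R" "\<And>v. v = f v + a (g v)"
    using R(2) by metis
  define \<psi> where "\<psi> v = f v + (t *s g v - a (g v))" for v
  have \<psi>: "\<psi> (r + a r') = r + (t *s r' - a r')" if "r \<in> R" "r' \<in> R" for r r'
  proof -
    let ?v = "r + a r'"
    have "(f ?v - r) + a (g ?v - r') = 0"
      using fg(3)[of ?v] by (simp add: generator_simps algebra_simps)
    then have "f ?v = r \<and> g ?v = r'"
      using free[of "f ?v - r" "g ?v - r'"] that fg(1,2) sub_simps by auto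
    then show ?thesis
      by (simp add: \<psi>_def)
  qed
  then have \<psi>E: "v = r + a r' \<Longrightarrow> r \<in> R \<Longrightarrow> r' \<in> R \<Longrightarrow> \<psi> v = r + (t *s r' - a r')" for v r r'
    by simp
  have "\<psi> (x + y) = \<psi> x + \<psi> y" for x y
  proof -
    obtain r r' s s' where d: "r \<in> R" "r' \<in> R" "x = r + a r'" "s \<in> R" "s' \<in> R" "y = s + a s'"
      using R(2) by metis
    have "x + y = (r + s) + a (r' + s')"
      by (simp add: d(3,6) generator_simps algebra_simps)
    then have "\<psi> (x + y) = (r + s) + (t *s (r' + s') - a (r' + s'))"
      by (rule \<psi>E) (use d sub_simps in auto)
    then show ?thesis
      unfolding d(3,6) \<psi>[OF d(1,2)] \<psi>[OF d(4,5)] by (simp add: generator_simps algebra_simps)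
  qed
  moreover have "\<psi> (c *s x) = c *s \<psi> x" for c x
  proof -
    obtain r r' where d: "r \<in> R" "r' \<in> R" "x = r + a r'"
      using R(2) by metis
    have "c *s x = c *s r + a (c *s r')"
      by (simp add: d(3) generator_simps algebra_simps)
    then have "\<psi> (c *s x) = c *s r + (t *s (c *s r') - a (c *s r'))"
      by (rule \<psi>E) (use d sub_simps in auto)
    then show ?thesis
      unfolding d(3) \<psi>[OF d(1,2)] by (simp add: generator_simps algebra_simps)
  qed
  moreover have "\<psi> (a x) = t *s \<psi> x - a (\<psi> x)" for x
  proof -
    obtain r r' where d: "r \<in> R" "r' \<in> R" "x = r + a r'"
      using R(2) by metis
    have "a x = - (m *s r') + a (r + t *s r')"
      by (simp add: d(3) generator_simps square algebra_simps)
    then have "\<psi> (a x) = - (m *s r') + (t *s (r + t *s r') - a (r + t *s r'))"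
      by (rule \<psi>E) (use d sub_simps in auto)
    then show ?thesis
      unfolding d(3) \<psi>[OF d(1,2)] by (simp add: generator_simps square algebra_simps)
  qed
  moreover have "bij \<psi>"
  proof -
    have "\<psi> (\<psi> x) = x" for x
    proof -
      obtain r r' where d: "r \<in> R" "r' \<in> R" "x = r + a r'"
        using R(2) by metis
      have "\<psi> x = (r + t *s r') + a (- r')"
        unfolding d(3) \<psi>[OF d(1,2)] by (simp add: generator_simps)
      then have "\<psi> (\<psi> x) = (r + t *s r') + (t *s (- r') - a (- r'))"
        by (rule \<psi>E) (use d sub_simps in auto)
      then show ?thesis
        by (simp add: d(3) generator_simps)
    qed
    then show ?thesis
      by (intro o_bij[of \<psi> \<psi>]) (simp_all add: fun_eq_iff)
  qed
  moreover have "q (\<psi> x) (\<psi> y) = q x y" for x y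
  proof -
    obtain r r' s s' where d: "r \<in> R" "r' \<in> R" "x = r + a r'" "s \<in> R" "s' \<in> R" "y = s + a s'"
      using R(2) by metis
    note s1 = skew_coeff_simps(1)[OF q]
    \<comment> \<open>On \<open>R\<close> the form \<open>h\<close> is traceless, which expresses
      \<open>t * q\<close> through \<open>2 * q\<close> with \<open>a\<close> moved inside.\<close>
    have 1: "t * q r s' = 2 * q r (a s')" "t * q r' s = 2 * q r' (a s)"
      "t * q r' s' = 2 * q r' (a s')"
      using s1[of r s'] s1[of r' s] s1[of r' s'] comm d by simp_all
    have "q (\<psi> x) (\<psi> y) = q x y - 2 * q r (a s') + t * q r s' + t * q r' s - 2 * q (a r') s
      + t * (t * q r' s' - q r' (a s') - q (a r') s')"
      unfolding d(3,6) \<psi>[OF d(1,2)] \<psi>[OF d(4,5)]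
      by (simp add: bilinear_form_simps[OF bil] algebra_simps)
    also have "\<dots> = q x y"
      using 1 comm[OF d(2,4)] comm[OF d(2,5)] by (simp add: algebra_simps)
    finally show ?thesis .
  qed
  ultimately show ?thesis
    by (intro exI[of _ \<psi>]) (simp add: linear_endo_iff)
qed

end

section \<open>Transport along a linear bijection intertwining two generators\<close>

text \<open>The conjugate t - a is the other root of the same polynomial. Passing to it reverses the
  sign of \<open>polar\<close>, which absorbs the sign -1 in the equivalence.\<close>

lemma (in separable_generator) conjugate_generator:
  "separable_generator scale L (\<lambda>x. t *s x - a x) t m"
proof unfold_locales
  have conj: "(\<lambda>x. t *s x - a x) = elem t (- 1)"
    by (simp add: elem_def)
  show "quadratic_extension scale L"
    by (rule quadratic)
  show "(\<lambda>x. t *s x - a x) \<in> L"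
    unfolding conj by (rule elem_in_L)
  show "(\<lambda>x. t *s x - a x) \<notin> range scale"
  proof
    assume "(\<lambda>x. t *s x - a x) \<in> range scale"
    then obtain k where "elem t (- 1) = elem k 0"
      unfolding conj elem_base(1) by blast
    then show False
      by (simp add: elem_eq_iff)
  qed
  show "t *s (t *s x - a x) - a (t *s x - a x) = t *s (t *s x - a x) - m *s x" for x
    by (simp add: generator_simps square algebra_simps)
  show "t * t - 4 * m \<noteq> 0"
    by (rule discriminant)
qed

lemma (in vector_space) alt_forms_pullback:
  assumes "s \<in> alt_forms scale" "Vector_Spaces.linear scale scale f"
  shows "(\<lambda>x y. s (f x) (f y)) \<in> alt_forms scale"
  using assms by (auto simp: alt_forms_def bilinear_form_iff linear_endo_iff)

lemma (in vector_space) linear_inv: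
  assumes "Vector_Spaces.linear scale scale f" "bij f"
  shows "Vector_Spaces.linear scale scale (inv f)"
proof -
  have f: "\<And>x y. f (x + y) = f x + f y" "\<And>c x. f (c *s x) = c *s f x"
    using assms(1) by (auto simp: linear_endo_iff)
  have "f (inv f x) = x" for x
    using assms(2) by (simp add: bij_is_surj surj_f_inv_f)
  then have "f (inv f (x + y)) = f (inv f x + inv f y)" "f (inv f (c *s x)) = f (c *s inv f x)" for x y c
    by (simp_all add: f)
  then show ?thesis
    using bij_is_inj[OF assms(2)] by (auto simp: linear_endo_iff inj_eq)
qed

locale separable_generator_pair =
  A: separable_generator scale L a t m + B: separable_generator scale L' a' t m
  for scale :: "'f::field \<Rightarrow> 'v::ab_group_add \<Rightarrow> 'v" (infixr \<open>*s\<close> 75) and L a t m L' a' +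
  fixes \<phi> :: "'v \<Rightarrow> 'v"
  assumes linear: "Vector_Spaces.linear scale scale \<phi>" and bij: "bij \<phi>"
    and intertwine: "\<phi> (a x) = a' (\<phi> x)"
begin

lemma inv_simps: "inv \<phi> (\<phi> x) = x" "\<phi> (inv \<phi> x) = x" "inv \<phi> (a' x) = a (inv \<phi> x)"
proof -
  show 1: "inv \<phi> (\<phi> x) = x" "\<phi> (inv \<phi> x) = x" for x
    using bij by (simp_all add: bij_is_inj bij_is_surj surj_f_inv_f)
  show "inv \<phi> (a' x) = a (inv \<phi> x)"
    using intertwine[of "inv \<phi> x"] 1 by metis
qed

text \<open>The polar form determines the values at (x, a x), and these determine the whole affine
  space.\<close>

lemma congruent_if_polar_eq:
  assumes S: "affine_alt_subspace scale S (W_space scale L)" "s \<in> S"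
    and S': "affine_alt_subspace scale S' (W_space scale L')" "s' \<in> S'"
    and polar: "\<And>x y. B.polar s' (\<phi> x) (\<phi> y) = A.polar s x y"
  shows "congruent_forms scale S S'"
proof -
  note s = A.affine_W_spaceE[OF S] and s' = B.affine_W_spaceE[OF S']
  have "(t * t - 4 * m) * s' (\<phi> x) (a' (\<phi> x)) = (t * t - 4 * m) * s x (a x)" for x
    unfolding A.discriminant_mult_alt_form[OF s(1)] B.discriminant_mult_alt_form[OF s'(1)]
    using polar[of x "a x"] polar[of x x] by (simp add: intertwine)
  then have diag: "s' (\<phi> x) (a' (\<phi> x)) = s x (a x)" for x
    using A.discriminant by simp
  have "S' = (\<lambda>s x y. s (inv \<phi> x) (inv \<phi> y)) ` S"
  proof (intro equalityI subsetI)
    fix r assume r: "r \<in> S'"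
    have "(\<lambda>x y. r (\<phi> x) (\<phi> y)) \<in> S"
      using r s(2) s'(2) A.alt_forms_pullback[OF _ linear, of r] by (simp add: intertwine diag)
    then show "r \<in> (\<lambda>s x y. s (inv \<phi> x) (inv \<phi> y)) ` S"
      by (rule image_eqI[rotated]) (simp add: inv_simps)
  next
    fix r assume "r \<in> (\<lambda>s x y. s (inv \<phi> x) (inv \<phi> y)) ` S"
    then obtain r0 where r0: "r0 \<in> S" "r = (\<lambda>x y. r0 (inv \<phi> x) (inv \<phi> y))"
      by blast
    have "r0 \<in> alt_forms scale" "\<And>x. r0 x (a x) = s x (a x)"
      using r0(1) s(2) by auto
    moreover have "s' x (a' x) = s (inv \<phi> x) (a (inv \<phi> x))" for x
      using diag[of "inv \<phi> x"] by (simp add: inv_simps)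
    ultimately show "r \<in> S'"
      using s'(2) A.alt_forms_pullback[OF _ A.linear_inv[OF linear bij], of r0]
      by (simp add: r0(2) inv_simps)
  qed
  then show ?thesis
    using linear bij by (auto simp: congruent_forms_def)
qed

text \<open>Conjugation by \<open>\<phi>\<close>: the isomorphism from \<open>L\<close> to
  \<open>L'\<close> that makes \<open>\<phi>\<close> semilinear.\<close>

definition transport :: "('v \<Rightarrow> 'v) \<Rightarrow> 'v \<Rightarrow> 'v" where
  "transport c = \<phi> \<circ> c \<circ> inv \<phi>"

lemma linear_simps: "\<phi> (x + y) = \<phi> x + \<phi> y" "\<phi> (c *s x) = c *s \<phi> x"
  using linear by (auto simp: A.linear_endo_iff)

lemma transport_elem: "transport (A.elem \<alpha> \<beta>) = B.elem \<alpha> \<beta>"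
  by (simp add: transport_def A.elem_def B.elem_def fun_eq_iff linear_simps intertwine inv_simps)

lemma alg_iso_transport: "alg_iso scale L L' transport"
proof -
  have "inj_on transport L"
    by (auto simp: inj_on_def transport_elem A.elem_eq_iff B.elem_eq_iff elim!: A.L_cases)
  moreover have "transport ` L = L'"
    unfolding A.L_eq B.L_eq image_image by (simp add: case_prod_beta' transport_elem)
  moreover have "transport (scale c) = scale c" for c
    using transport_elem[of c 0] by (simp only: A.elem_base B.elem_base)
  moreover have "transport (b + c) = transport b + transport c" "transport (b \<circ> c) = transport b \<circ> transport c"
    for b c
    by (simp_all add: transport_def fun_eq_iff linear_simps inv_simps)
  ultimately show ?thesis
    by (simp add: alg_iso_def bij_betw_def)
qed

text \<open>The transported form has the same coefficients in the generator \<open>a'\<close>, so a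
  congruence yields an equivalence with sign +1.\<close>

lemma equivalent_if_congruent:
  assumes S: "affine_alt_subspace scale S (W_space scale L)" "s \<in> S"
    and S': "affine_alt_subspace scale S' (W_space scale L')" "(\<lambda>x y. s (inv \<phi> x) (inv \<phi> y)) \<in> S'"
  shows "equivalent_up_to_sign scale L L' (assoc_form scale L S) (assoc_form scale L' S')"
proof -
  have "assoc_form scale L' S' (\<phi> x) (\<phi> y) = transport (assoc_form scale L S x y)" for x y
    unfolding A.assoc_form_eq[OF S] B.assoc_form_eq[OF S'] A.herm_def B.herm_def transport_elem
    by (simp add: A.alt_coeff_def B.alt_coeff_def A.polar_def B.polar_def inv_simps)
  moreover have "\<phi> (b x) = transport b (\<phi> x)" for b x
    by (simp add: transport_def inv_simps)
  ultimately show ?thesis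
    unfolding equivalent_up_to_sign_def using alg_iso_transport bij linear_simps(1) by blast
qed

end

section \<open>The criterion for congruence\<close>

context separable_generator
begin

text \<open>Conjugating back by \<open>\<phi>\<close> carries \<open>L'\<close> into
  \<open>L\<close>, because \<open>L\<close> is characterized by \<open>W\<^sub>L\<close>. The
  conjugate of \<open>a\<close> then generates \<open>L'\<close> with the same \<open>t\<close> and
  \<open>m\<close>, so the separability of \<open>L'\<close> is a consequence.\<close>

lemma congruent_imp_generator:
  assumes dim: "dim (UNIV :: 'v set) \<ge> 4"
    and L': "quadratic_extension scale L'"
    and S: "affine_alt_subspace scale S (W_space scale L)"
    and S': "affine_alt_subspace scale S' (W_space scale L')"
    and \<phi>: "Vector_Spaces.linear scale scale \<phi>" "bij \<phi>" "S' = (\<lambda>s x y. s (inv \<phi> x) (inv \<phi> y)) ` S"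
  shows "separable_generator_pair scale L a t m L' (\<phi> \<circ> a \<circ> inv \<phi>) \<phi>"
proof -
  interpret E: vector_space "end_scale scale"
    by (rule vector_space_end_scale)
  have inv: "inv \<phi> (\<phi> x) = x" "\<phi> (inv \<phi> x) = x" for x
    using \<phi>(2) by (simp_all add: bij_is_inj bij_is_surj surj_f_inv_f)
  note lin = \<phi>(1)[unfolded linear_endo_iff] linear_inv[OF \<phi>(1,2), unfolded linear_endo_iff]
  have \<phi>_diff: "\<phi> (x - y) = \<phi> x - \<phi> y" for x y
    using lin(1) by (metis add_diff_cancel_right' diff_add_cancel)
  have L'_lin: "u (x + y) = u x + u y" "u (c *s x) = c *s u x" if "u \<in> L'" for u x y c
    using L' that by (auto simp: quadratic_extension_def linear_endo_iff)
  obtain s where s: "s \<in> S"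
    using affine_nonempty[OF S] by blast
  have conj: "inv \<phi> \<circ> u \<circ> \<phi> \<in> L" if u: "u \<in> L'" for u
  proof (rule W_space_recovers_L[OF dim])
    show "Vector_Spaces.linear scale scale (inv \<phi> \<circ> u \<circ> \<phi>)"
      using lin L'_lin[OF u] by (simp add: linear_endo_iff)
    fix w x assume w: "w \<in> W_space scale L"
    have "s + w \<in> S"
      using affine_W_spaceE[OF S s] w
      by (auto simp: W_space_iff alt_forms_def bilinear_form_iff algebra_simps)
    obtain s0 where s0: "S' = (\<lambda>w. s0 + w) ` W_space scale L'"
      using S' by (auto simp: affine_alt_subspace_def)
    \<comment> \<open>All members of \<open>S'\<close> agree at (y, u y); applied to the images of
      \<open>s\<close> and \<open>s + w\<close>, this leaves only the contribution of
      \<open>w\<close>, which must vanish.\<close>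
    have same: "r y (u y) = s0 y (u y)" if "r \<in> S'" for r y
      using that u by (auto simp: s0 W_space_def)
    have "(\<lambda>x y. s (inv \<phi> x) (inv \<phi> y)) \<in> S'" "(\<lambda>x y. (s + w) (inv \<phi> x) (inv \<phi> y)) \<in> S'"
      unfolding \<phi>(3) using s \<open>s + w \<in> S\<close> by blast+
    from same[OF this(1), of "\<phi> x"] same[OF this(2), of "\<phi> x"]
    show "w x ((inv \<phi> \<circ> u \<circ> \<phi>) x) = 0"
      by (simp add: inv)
  qed
  obtain u where u: "u \<in> L'" "u \<notin> range scale"
    using quadratic_extension_not_scalar[OF L'] by blast
  obtain \<alpha> \<beta> where ab: "inv \<phi> \<circ> u \<circ> \<phi> = elem \<alpha> \<beta>"
    using L_cases conj[OF u(1)] by blast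
  have u_eq: "u x = \<alpha> *s x + \<beta> *s \<phi> (a (inv \<phi> x))" for x
  proof -
    have "\<phi> ((inv \<phi> \<circ> u \<circ> \<phi>) (inv \<phi> x)) = \<phi> (elem \<alpha> \<beta> (inv \<phi> x))"
      unfolding ab ..
    then show ?thesis
      using lin(1) by (simp add: inv elem_def)
  qed
  have "\<beta> \<noteq> 0"
  proof
    assume "\<beta> = 0"
    then have "u = scale \<alpha>"
      by (simp add: fun_eq_iff u_eq)
    then show False
      using u(2) by blast
  qed
  let ?a = "\<phi> \<circ> a \<circ> inv \<phi>"
  \<comment> \<open>Solving u = \<alpha> + \<beta> \<phi> a \<phi>^-1 for the conjugate of
    \<open>a\<close> places it in \<open>L'\<close>.\<close>
  have "?a = end_scale scale (inverse \<beta>) (u - scale \<alpha>)"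
    using \<open>\<beta> \<noteq> 0\<close> by (simp add: fun_eq_iff end_scale_def u_eq)
  moreover have "scale \<alpha> \<in> L'" "E.subspace L'"
    using L' by (auto simp: quadratic_extension_def)
  ultimately have a_L': "?a \<in> L'"
    using E.subspace_scale E.subspace_diff u(1) by metis
  have a_not_scalar: "?a \<notin> range scale"
  proof
    assume "?a \<in> range scale"
    then obtain k where "?a = scale k" by blast
    then have "\<phi> (a (inv \<phi> (\<phi> x))) = k *s \<phi> x" for x
      by (simp add: fun_eq_iff)
    then have "inv \<phi> (\<phi> (a x)) = inv \<phi> (k *s \<phi> x)" for x
      by (simp add: inv)
    then have "a = scale k"
      using lin(2) by (simp add: inv fun_eq_iff)
    then show False
      using generator(2) by blast
  qed
  have square': "?a (?a x) = t *s ?a x - m *s x" for x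
    using lin(1) by (simp add: inv square \<phi>_diff)
  interpret B: separable_generator scale L' ?a t m
    using L' a_L' a_not_scalar square' discriminant by unfold_locales
  show ?thesis
    by (intro separable_generator_pair.intro separable_generator_pair_axioms.intro
        separable_generator_axioms B.separable_generator_axioms \<phi>(1,2)) (simp add: inv)
qed

lemma congruent_iff_equivalent:
  assumes dim: "dim (UNIV :: 'v set) \<ge> 4"
    and L': "quadratic_extension scale L'"
    and S: "affine_alt_subspace scale S (W_space scale L)"
    and S': "affine_alt_subspace scale S' (W_space scale L')"
  shows "congruent_forms scale S S' \<longleftrightarrow> (\<exists>\<theta>. alg_iso scale L L' \<theta>) \<and>
    equivalent_up_to_sign scale L L' (assoc_form scale L S) (assoc_form scale L' S')"
proof
  assume "congruent_forms scale S S'"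
  then obtain \<phi> where \<phi>: "Vector_Spaces.linear scale scale \<phi>" "bij \<phi>"
    "S' = (\<lambda>s x y. s (inv \<phi> x) (inv \<phi> y)) ` S"
    by (auto simp: congruent_forms_def)
  then interpret P: separable_generator_pair scale L a t m L' "\<phi> \<circ> a \<circ> inv \<phi>" \<phi>
    by (rule congruent_imp_generator[OF assms])
  obtain s where "s \<in> S"
    using affine_nonempty[OF S] by blast
  then show "(\<exists>\<theta>. alg_iso scale L L' \<theta>) \<and>
    equivalent_up_to_sign scale L L' (assoc_form scale L S) (assoc_form scale L' S')"
    using P.alg_iso_transport P.equivalent_if_congruent[OF S _ S'] \<phi>(3) by blast
next
  assume "(\<exists>\<theta>. alg_iso scale L L' \<theta>) \<and>
    equivalent_up_to_sign scale L L' (assoc_form scale L S) (assoc_form scale L' S')"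
  then obtain \<theta> \<phi> where iso: "alg_iso scale L L' \<theta>" and bij: "bij \<phi>"
    and \<phi>_add: "\<And>x y. \<phi> (x + y) = \<phi> x + \<phi> y"
    and semi: "\<And>b x. b \<in> L \<Longrightarrow> \<phi> (b x) = \<theta> b (\<phi> x)"
    and sign: "(\<forall>x y. assoc_form scale L' S' (\<phi> x) (\<phi> y) = \<theta> (assoc_form scale L S x y)) \<or>
      (\<forall>x y. assoc_form scale L' S' (\<phi> x) (\<phi> y) = - \<theta> (assoc_form scale L S x y))"
    unfolding equivalent_up_to_sign_def by blast
  have \<theta>_bij: "bij_betw \<theta> L L'" and \<theta>_scale: "\<And>c. \<theta> (scale c) = scale c"
    and \<theta>_hom: "\<And>b c. b \<in> L \<Longrightarrow> c \<in> L \<Longrightarrow> \<theta> (b + c) = \<theta> b + \<theta> c \<and> \<theta> (b \<circ> c) = \<theta> b \<circ> \<theta> c"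
    using iso unfolding alg_iso_def by blast+
  have scale_L: "scale c \<in> L" for c
    using elem_in_L[of c 0] by (simp only: elem_base)
  \<comment> \<open>An isomorphism fixes the scalars, so semilinearity contains linearity over the
    base field.\<close>
  have linear: "Vector_Spaces.linear scale scale \<phi>"
    using \<phi>_add semi[OF scale_L] by (simp add: linear_endo_iff \<theta>_scale)
  have \<theta>_elem: "\<theta> (elem \<alpha> \<beta>) = (\<lambda>x. \<alpha> *s x + \<beta> *s \<theta> a x)" for \<alpha> \<beta>
  proof -
    have "elem \<alpha> \<beta> = scale \<alpha> + (scale \<beta> \<circ> a)"
      by (simp add: elem_def fun_eq_iff)
    moreover have "scale \<beta> \<circ> a = elem 0 \<beta>"
      by (simp add: elem_def fun_eq_iff)
    ultimately have "\<theta> (elem \<alpha> \<beta>) = \<theta> (scale \<alpha>) + (\<theta> (scale \<beta>) \<circ> \<theta> a)"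
      using \<theta>_hom[OF scale_L[of \<alpha>], of "scale \<beta> \<circ> a"] \<theta>_hom[OF scale_L generator(1), of \<beta>] elem_in_L
      by simp
    then show ?thesis
      by (simp add: \<theta>_scale fun_eq_iff)
  qed
  have "a \<circ> a = elem (- m) t"
    using elem_comp[of 0 1 0 1] by (simp add: elem_base)
  then have "\<theta> a \<circ> \<theta> a = \<theta> (elem (- m) t)"
    using \<theta>_hom[OF generator(1) generator(1)] by simp
  then have "\<theta> a (\<theta> a x) = t *s \<theta> a x - m *s x" for x
    unfolding \<theta>_elem by (simp add: fun_eq_iff)
  moreover have "\<theta> a \<in> L'"
    using \<theta>_bij generator(1) by (auto dest: bij_betwE)
  moreover have "\<theta> a \<notin> range scale"
  proof
    assume "\<theta> a \<in> range scale"
    then obtain k where "\<theta> a = \<theta> (scale k)"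
      by (auto simp: \<theta>_scale)
    then have "a = scale k"
      using \<theta>_bij generator(1) scale_L by (auto simp: bij_betw_def inj_on_def)
    then show False
      using generator(2) by blast
  qed
  ultimately interpret G: separable_generator scale L' "\<theta> a" t m
    using L' discriminant by unfold_locales
  obtain s s' where s: "s \<in> S" "s' \<in> S'"
    using affine_nonempty[OF S] G.affine_nonempty[OF S'] by blast
  note forms = assoc_form_eq[OF S s(1)] G.assoc_form_eq[OF S' s(2)] herm_def G.herm_def
  have "\<theta> (elem \<alpha> \<beta>) = G.elem \<alpha> \<beta>" for \<alpha> \<beta>
    by (simp add: \<theta>_elem G.elem_def)
  note forms = forms this G.elem_uminus
  from sign show "congruent_forms scale S S'"
  proof
    assume "\<forall>x y. assoc_form scale L' S' (\<phi> x) (\<phi> y) = \<theta> (assoc_form scale L S x y)"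
    then have "G.alt_coeff s' (\<phi> x) (\<phi> y) = alt_coeff s x y" for x y
      unfolding forms G.elem_eq_iff by blast
    then have polar: "G.polar s' (\<phi> x) (\<phi> y) = polar s x y" for x y
      using discriminant by (simp add: alt_coeff_def G.alt_coeff_def)
    interpret P: separable_generator_pair scale L a t m L' "\<theta> a" \<phi>
      by (intro separable_generator_pair.intro separable_generator_pair_axioms.intro
          separable_generator_axioms G.separable_generator_axioms linear bij semi generator(1))
    show ?thesis
      by (rule P.congruent_if_polar_eq[OF S s(1) S' s(2) polar])
  next
    assume "\<forall>x y. assoc_form scale L' S' (\<phi> x) (\<phi> y) = - \<theta> (assoc_form scale L S x y)"
    then have "G.alt_coeff s' (\<phi> x) (\<phi> y) = - alt_coeff s x y" for x y
      unfolding forms G.elem_eq_iff by blast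
    moreover have "polar s x y = (t * t - 4 * m) * alt_coeff s x y"
      "G.polar s' x y = (t * t - 4 * m) * G.alt_coeff s' x y" for x y
      using discriminant by (simp_all add: alt_coeff_def G.alt_coeff_def)
    ultimately have neg: "G.polar s' (\<phi> x) (\<phi> y) = - polar s x y" for x y
      by (simp only: mult_minus_right)
    \<comment> \<open>With sign -1, \<open>\<phi>\<close> is precomposed with a conjugation
      \<open>\<psi>\<close> preserving \<open>polar s\<close>; the composite intertwines
      \<open>a\<close> with the conjugate of \<open>\<theta> a\<close>.\<close>
    obtain \<psi> where \<psi>: "Vector_Spaces.linear scale scale \<psi>" "bij \<psi>"
      "\<And>x. \<psi> (a x) = t *s \<psi> x - a (\<psi> x)" "\<And>x y. alt_coeff s (\<psi> x) (\<psi> y) = alt_coeff s x y"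
      using conjugation_exists[OF skew_coeff_alt_coeff[OF affine_W_spaceE(1)[OF S s(1)]]] dim by auto
    have polar_\<psi>: "polar s (\<psi> x) (\<psi> y) = polar s x y" for x y
      using \<psi>(4)[of x y] discriminant by (simp add: alt_coeff_def)
    interpret C: separable_generator scale L' "\<lambda>x. t *s x - \<theta> a x" t m
      by (rule G.conjugate_generator)
    interpret P: separable_generator_pair scale L a t m L' "\<lambda>x. t *s x - \<theta> a x" "\<phi> \<circ> \<psi>"
    proof (intro separable_generator_pair.intro separable_generator_pair_axioms.intro
        separable_generator_axioms C.separable_generator_axioms)
      show "Vector_Spaces.linear scale scale (\<phi> \<circ> \<psi>)"
        using linear \<psi>(1) by (simp add: linear_endo_iff)
      show "bij (\<phi> \<circ> \<psi>)"
        by (rule bij_comp[OF \<psi>(2) bij])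
      have "\<phi> (x - y) = \<phi> x - \<phi> y" for x y
        using \<phi>_add by (metis add_diff_cancel_right' diff_add_cancel)
      then show "(\<phi> \<circ> \<psi>) (a x) = t *s (\<phi> \<circ> \<psi>) x - \<theta> a ((\<phi> \<circ> \<psi>) x)" for x
        using linear semi[OF generator(1)] by (simp add: \<psi>(3) linear_endo_iff)
    qed
    have "bilinear_form scale s'"
      using G.affine_W_spaceE(1)[OF S' s(2)] by (simp add: alt_forms_def)
    \<comment> \<open>The term with \<open>t\<close> cancels by bilinearity, leaving the second
      change of sign, which compensates the one in \<open>neg\<close>.\<close>
    then have "C.polar s' x y = - G.polar s' x y" for x y
      by (simp add: C.polar_def G.polar_def bilinear_form_simps)
    then have "C.polar s' ((\<phi> \<circ> \<psi>) x) ((\<phi> \<circ> \<psi>) y) = polar s x y" for x y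
      by (simp add: neg polar_\<psi>)
    then show ?thesis
      by (rule P.congruent_if_polar_eq[OF S s(1) S' s(2)])
  qed
qed

end

theorem theorem1p11:
  fixes scale :: "'f::field \<Rightarrow> 'v::ab_group_add \<Rightarrow> 'v"
    and n :: nat and L :: "('v \<Rightarrow> 'v) set"
  assumes "vector_space scale"
    and "vector_space.dim scale UNIV = 2 * n" and "2 * n \<ge> 4"
    and "quadratic_extension scale L" and "separable_extension scale L"
  shows "(\<forall>S. affine_alt_subspace scale S (W_space scale L) \<longrightarrow>
            (\<exists>!h. skew_hermitian scale L h \<and> (\<forall>s\<in>S. trace_compatible scale L h s)))
    \<and> (\<forall>h. skew_hermitian scale L h \<longrightarrow>
            affine_alt_subspace scale {s \<in> alt_forms scale. trace_compatible scale L h s}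
              (W_space scale L) \<and>
            (symplectic {s \<in> alt_forms scale. trace_compatible scale L h s} \<longleftrightarrow> nonisotropic h))
    \<and> (\<forall>L' S S'. quadratic_extension scale L' \<longrightarrow>
            affine_alt_subspace scale S (W_space scale L) \<longrightarrow>
            affine_alt_subspace scale S' (W_space scale L') \<longrightarrow>
            (congruent_forms scale S S' \<longleftrightarrow>
              (\<exists>\<theta>. alg_iso scale L L' \<theta>) \<and>
              equivalent_up_to_sign scale L L' (assoc_form scale L S) (assoc_form scale L' S')))"
proof -
  interpret vector_space scale
    by (rule assms(1))
  obtain a t m where "separable_generator scale L a t m"
    using separable_generator_exists[OF assms(4,5)] .
  then interpret separable_generator scale L a t m .
  have dim: "dim (UNIV :: 'v set) \<ge> 4"
    using assms(2,3) by simp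
  show ?thesis
  proof (intro conjI allI impI)
    fix S assume S: "affine_alt_subspace scale S (W_space scale L)"
    then obtain s where "s \<in> S"
      using affine_nonempty by blast
    then show "\<exists>!h. skew_hermitian scale L h \<and> (\<forall>s\<in>S. trace_compatible scale L h s)"
      \<comment> \<open>The condition on \<open>h\<close> is an equation with a fixed form, so
        unique existence is immediate.\<close>
      unfolding affine_trace_compatible_iff[OF S \<open>s \<in> S\<close>] by simp
  next
    fix h assume "skew_hermitian scale L h"
    then obtain q where q: "skew_coeff q" "h = herm q"
      by (auto simp: skew_hermitian_iff)
    show "affine_alt_subspace scale {s \<in> alt_forms scale. trace_compatible scale L h s} (W_space scale L)"
      unfolding q(2) by (rule compatible_forms_affine[OF q(1)])
    show "symplectic {s \<in> alt_forms scale. trace_compatible scale L h s} \<longleftrightarrow> nonisotropic h"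
      unfolding q(2) by (rule symplectic_iff_nonisotropic[OF q(1)])
  qed (rule congruent_iff_equivalent[OF dim])
qed

end
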